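(* Let $(R,\mathfrak{m})$ be a Noetherian local ring and let $M$ be a nonzero finitely generated $R$-module. If the projective dimension of $M$ is finite, then $$\operatorname{projdim}(M)+\operatorname{depth}(M)=\operatorname{depth}(R).$$
   Context: Rings are commutative with unit. For $R$-modules $N,M$, $\operatorname{depth}(N,M)\in\mathbb{N}\cup\{\infty\}$ is the least $i$ with $\operatorname{Ext}^i_R(N,M)\neq 0$ (and $\infty$ if there is no such $i$). For a local ring $(R,\mathfrak{m})$, $\operatorname{depth}(M):=\operatorname{depth}(R/\mathfrak{m},M)$, and $\operatorname{depth}(R)$ is the depth of $R$ as a module over itself. $\operatorname{projdim}(M)$ is the projective dimension of $M$. *)

theory Defs
  imports "HOL-Algebra.Module" "HOL-Algebra.Ring_Divisibility" "HOL-Library.Extended_Nat"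
begin

text \<open>
  Modules are those of HOL-Algebra. The record type there extends the one of rings, but the
  locale \<^locale>\<open>module\<close> ignores the fields \<^const>\<open>mult\<close> and \<^const>\<open>one\<close> of the module;
  where there is no sensible value they are left unspecified.
\<close>

definition local_ring :: "('r, 'a) ring_scheme \<Rightarrow> 'r set \<Rightarrow> bool"
  where "local_ring R \<mm> \<longleftrightarrow>
    cring R \<and> maximalideal \<mm> R \<and> (\<forall>J. maximalideal J R \<longrightarrow> J = \<mm>)"

definition self_module :: "('r, 'a) ring_scheme \<Rightarrow> ('r, 'r) module"
  where "self_module R =
    \<lparr>carrier = carrier R, mult = mult R, one = \<one>\<^bsub>R\<^esub>, zero = \<zero>\<^bsub>R\<^esub>, add = add R,
     smult = mult R\<rparr>"

definition fin_gen_module :: "('r, 'a) ring_scheme \<Rightarrow> ('r, 'm, 'b) module_scheme \<Rightarrow> bool"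
  where "fin_gen_module R M \<longleftrightarrow>
    module R M \<and>
    (\<exists>S. finite S \<and> S \<subseteq> carrier M \<and>
      (\<forall>x\<in>carrier M. \<exists>c\<in>S \<rightarrow> carrier R. x = (\<Oplus>\<^bsub>M\<^esub>s\<in>S. c s \<odot>\<^bsub>M\<^esub> s)))"

text \<open>The quotient of a module by a submodule \<open>K\<close>; its elements are the additive cosets of \<open>K\<close>.\<close>

definition quot_module :: "('r, 'm, 'b) module_scheme \<Rightarrow> 'm set \<Rightarrow> ('r, 'm set) module"
  where "quot_module M K =
    \<lparr>carrier = a_rcosets\<^bsub>M\<^esub> K, mult = undefined, one = undefined, zero = K, add = set_add M,
     smult = (\<lambda>a X. \<Union>x\<in>X. K +>\<^bsub>M\<^esub> (a \<odot>\<^bsub>M\<^esub> x))\<rparr>"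

text \<open>
  The module of \<open>R\<close>-linear maps. Its elements are extensional functions, so that a linear map is
  determined by its values on the carrier.
\<close>

definition hom_module ::
  "('r, 'a) ring_scheme \<Rightarrow> ('r, 'n, 'b) module_scheme \<Rightarrow> ('r, 'm, 'c) module_scheme
    \<Rightarrow> ('r, 'n \<Rightarrow> 'm) module"
  where "hom_module R N M =
    \<lparr>carrier = {f \<in> carrier N \<rightarrow>\<^sub>E carrier M.
        (\<forall>x\<in>carrier N. \<forall>y\<in>carrier N. f (x \<oplus>\<^bsub>N\<^esub> y) = f x \<oplus>\<^bsub>M\<^esub> f y) \<and>
        (\<forall>a\<in>carrier R. \<forall>x\<in>carrier N. f (a \<odot>\<^bsub>N\<^esub> x) = a \<odot>\<^bsub>M\<^esub> f x)},
     mult = undefined, one = undefined,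
     zero = (\<lambda>x\<in>carrier N. \<zero>\<^bsub>M\<^esub>),
     add = (\<lambda>f g. \<lambda>x\<in>carrier N. f x \<oplus>\<^bsub>M\<^esub> g x),
     smult = (\<lambda>a f. \<lambda>x\<in>carrier N. a \<odot>\<^bsub>M\<^esub> f x)\<rparr>"

abbreviation mod_hom ::
  "('r, 'a) ring_scheme \<Rightarrow> ('r, 'n, 'b) module_scheme \<Rightarrow> ('r, 'm, 'c) module_scheme
    \<Rightarrow> ('n \<Rightarrow> 'm) set"
  where "mod_hom R N M \<equiv> carrier (hom_module R N M)"

text \<open>
  Projectivity is the lifting property against all epimorphisms \<open>g : N \<rightarrow> L\<close>. A definition in HOL
  has to fix the element types of the test modules \<open>N\<close> and \<open>L\<close>; the types below are large enough:
  they admit the epimorphism onto \<open>L = P\<close> from the free module \<open>N\<close> on the set \<open>carrier P\<close> (finitely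
  supported functions). Lifting the identity along it exhibits \<open>P\<close> as a direct summand of a free
  module, so \<open>P\<close> then has the lifting property against epimorphisms of modules over any types.
\<close>

definition projective_module :: "('r, 'a) ring_scheme \<Rightarrow> ('r, 'p) module \<Rightarrow> bool"
  where "projective_module R P \<longleftrightarrow>
    module R P \<and>
    (\<forall>(N :: ('r, 'p \<Rightarrow> 'r) module) (L :: ('r, 'p) module). \<forall>g\<in>mod_hom R N L. \<forall>f\<in>mod_hom R P L.
      module R N \<and> module R L \<and> g ` carrier N = carrier L \<longrightarrow>
      (\<exists>h\<in>mod_hom R P N. \<forall>x\<in>carrier P. g (h x) = f x))"

text \<open>A projective resolution \<open>\<dots> \<rightarrow> P 2 \<rightarrow> P 1 \<rightarrow> P 0 \<rightarrow> N \<rightarrow> 0\<close> with \<open>d i : P (i + 1) \<rightarrow> P i\<close>:\<close>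

definition projective_resolution ::
  "('r, 'a) ring_scheme \<Rightarrow> ('r, 'n, 'b) module_scheme
    \<Rightarrow> (nat \<Rightarrow> ('r, 'p) module) \<Rightarrow> (nat \<Rightarrow> 'p \<Rightarrow> 'p) \<Rightarrow> ('p \<Rightarrow> 'n) \<Rightarrow> bool"
  where "projective_resolution R N P d \<epsilon> \<longleftrightarrow>
    (\<forall>i. projective_module R (P i)) \<and>
    (\<forall>i. d i \<in> mod_hom R (P (Suc i)) (P i)) \<and>
    \<epsilon> \<in> mod_hom R (P 0) N \<and>
    \<epsilon> ` carrier (P 0) = carrier N \<and>
    d 0 ` carrier (P 1) = a_kernel (P 0) N \<epsilon> \<and>
    (\<forall>i. d (Suc i) ` carrier (P (Suc (Suc i))) = a_kernel (P (Suc i)) (P i) (d i))"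

text \<open>
  An element type for the terms of projective resolutions of a module with elements in \<open>'n\<close> over
  a ring with elements in \<open>'r\<close>. It involves no loss of generality. The type \<open>('r + 'n) list\<close> is
  infinite and at least as large as \<open>'r\<close> and \<open>'n\<close>, so it can index the bases of a
  free resolution built by successively covering kernels; the terms themselves consist of
  finitely supported functions in \<open>('r + 'n) list \<Rightarrow> 'r\<close>. By Schanuel's lemma, if the
  module has a projective resolution of length \<open>n\<close> over any type, then truncating such a free
  resolution at the kernel in degree \<open>n\<close> gives one over this type (for \<open>n = 0\<close>, the module itself
  embeds into the type via indicator functions).
\<close>

type_synonym ('r, 'n) res = "('r + 'n) list \<Rightarrow> 'r"

definition proj_dim :: "('r, 'a) ring_scheme \<Rightarrow> ('r, 'm, 'b) module_scheme \<Rightarrow> enat"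
  where "proj_dim R M =
    Inf {enat n | n. \<exists>(P :: nat \<Rightarrow> ('r, ('r, 'm) res) module) d \<epsilon>.
      projective_resolution R M P d \<epsilon> \<and> (\<forall>i>n. carrier (P i) = {\<zero>\<^bsub>P i\<^esub>})}"

text \<open>
  \<open>Ext i\<close> is the \<open>i\<close>-th cohomology module of the complex \<open>Hom (P i) M\<close>, where \<open>P\<close> is a chosen
  projective resolution of \<open>N\<close>; it does not depend on the choice up to isomorphism.
\<close>

definition codiff ::
  "(nat \<Rightarrow> ('r, 'p) module) \<Rightarrow> (nat \<Rightarrow> 'p \<Rightarrow> 'p) \<Rightarrow> nat \<Rightarrow> ('p \<Rightarrow> 'm) \<Rightarrow> ('p \<Rightarrow> 'm)"
  where "codiff P d i f = compose (carrier (P (Suc i))) f (d i)"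

definition cocycles ::
  "('r, 'a) ring_scheme \<Rightarrow> (nat \<Rightarrow> ('r, 'p) module) \<Rightarrow> (nat \<Rightarrow> 'p \<Rightarrow> 'p)
    \<Rightarrow> ('r, 'm, 'b) module_scheme \<Rightarrow> nat \<Rightarrow> ('p \<Rightarrow> 'm) set"
  where "cocycles R P d M i =
    a_kernel (hom_module R (P i) M) (hom_module R (P (Suc i)) M) (codiff P d i)"

fun coboundaries ::
  "('r, 'a) ring_scheme \<Rightarrow> (nat \<Rightarrow> ('r, 'p) module) \<Rightarrow> (nat \<Rightarrow> 'p \<Rightarrow> 'p)
    \<Rightarrow> ('r, 'm, 'b) module_scheme \<Rightarrow> nat \<Rightarrow> ('p \<Rightarrow> 'm) set"
  where
    "coboundaries R P d M 0 = {\<zero>\<^bsub>hom_module R (P 0) M\<^esub>}"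
  | "coboundaries R P d M (Suc i) = codiff P d i ` mod_hom R (P i) M"

definition chosen_resolution ::
  "('r, 'a) ring_scheme \<Rightarrow> ('r, 'n, 'b) module_scheme
    \<Rightarrow> (nat \<Rightarrow> ('r, ('r, 'n) res) module) \<times> (nat \<Rightarrow> ('r, 'n) res \<Rightarrow> ('r, 'n) res)"
  where "chosen_resolution R N = (SOME (P, d). \<exists>\<epsilon>. projective_resolution R N P d \<epsilon>)"

definition Ext ::
  "('r, 'a) ring_scheme \<Rightarrow> nat \<Rightarrow> ('r, 'n, 'b) module_scheme \<Rightarrow> ('r, 'm, 'c) module_scheme
    \<Rightarrow> ('r, (('r, 'n) res \<Rightarrow> 'm) set) module"
  where "Ext R i N M =
    (case chosen_resolution R N of (P, d) \<Rightarrow>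
      quot_module ((hom_module R (P i) M)\<lparr>carrier := cocycles R P d M i\<rparr>)
        (coboundaries R P d M i))"

text \<open>The infimum of the empty set is \<open>\<infinity>\<close>.\<close>

definition depth_pair ::
  "('r, 'a) ring_scheme \<Rightarrow> ('r, 'n, 'b) module_scheme \<Rightarrow> ('r, 'm, 'c) module_scheme \<Rightarrow> enat"
  where "depth_pair R N M = Inf {enat i | i. carrier (Ext R i N M) \<noteq> {\<zero>\<^bsub>Ext R i N M\<^esub>}}"

definition depth :: "('r, 'a) ring_scheme \<Rightarrow> 'r set \<Rightarrow> ('r, 'm, 'b) module_scheme \<Rightarrow> enat"
  where "depth R \<mm> M = depth_pair R (quot_module (self_module R) \<mm>) M"

end

theory Submission
  imports Defs
begin

text \<open>
  Over a Noetherian local ring \<open>R\<close> a finitely generated module \<open>M\<close> has a free resolution \<open>F\<close> of finite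
  ranks whose differentials have entries in the maximal ideal. A projective resolution \<open>Q\<close> of
  length \<open>n\<close> forces \<open>F\<close> to have length at most \<open>n\<close>: the comparison maps \<open>F \<rightarrow> Q \<rightarrow> F\<close> compose to a map
  homotopic to the identity, and modulo the maximal ideal the homotopy vanishes while in degrees
  above \<open>n\<close> the composite is zero.

  The formula follows by induction on the length of \<open>F\<close>, using the long exact sequence of
  \<open>0 \<rightarrow> K \<rightarrow> F 0 \<rightarrow> M \<rightarrow> 0\<close>: it yields \<open>1 + depth M = depth K\<close> as soon as \<open>depth K \<le> depth R\<close> and
  \<open>Ext i k K \<rightarrow> Ext i k (F 0)\<close> is zero for \<open>i \<le> depth K\<close>. If \<open>K\<close> is free, the map is zero because it has
  entries in the maximal ideal, which annihilates \<open>Ext i k R\<close>; otherwise the target is zero, since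
  \<open>depth K < depth R\<close> or both are infinite.
\<close>

text \<open>Only the vanishing of Ext matters, so no Ext module is manipulated before the very end:
  Ext^i = 0 is read as "every cocycle is a coboundary", and the long exact sequence becomes three
  diagram chases about this predicate. The resolution of the residue field is picked by
  \<open>SOME\<close>, so it has to stay arbitrary; it enters through one property, that elements of
  the maximal ideal act on it null-homotopically. Two obstacles shape the rest. Element types are
  fixed in HOL: all free modules of a resolution live in one function type, the syzygies of
  \<open>M\<close> share it, and \<open>M\<close> itself, of another type, gets its own first step.
  Depths are extended naturals: the shift is written 1 + depth M = depth K, which also covers
  infinite values. The length of F equals the projective dimension because F itself competes in the
  infimum that defines it, while the homotopy argument gives the other inequality.\<close>

section \<open>Linear maps and free modules\<close>

text \<open>
  Unlike \<open>mod_hom\<close>, this puts no condition on the values outside the carrier.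
\<close>

definition linmap ::
  "('r, 'a) ring_scheme \<Rightarrow> ('r, 'n, 'b) module_scheme \<Rightarrow> ('r, 'm, 'c) module_scheme
    \<Rightarrow> ('n \<Rightarrow> 'm) \<Rightarrow> bool"
  where "linmap R N M f \<longleftrightarrow>
    (\<forall>x\<in>carrier N. f x \<in> carrier M) \<and>
    (\<forall>x\<in>carrier N. \<forall>y\<in>carrier N. f (x \<oplus>\<^bsub>N\<^esub> y) = f x \<oplus>\<^bsub>M\<^esub> f y) \<and>
    (\<forall>a\<in>carrier R. \<forall>x\<in>carrier N. f (a \<odot>\<^bsub>N\<^esub> x) = a \<odot>\<^bsub>M\<^esub> f x)"

lemma linmap_closed: "linmap R N M f \<Longrightarrow> x \<in> carrier N \<Longrightarrow> f x \<in> carrier M"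
  and linmap_add: "linmap R N M f \<Longrightarrow> x \<in> carrier N \<Longrightarrow> y \<in> carrier N \<Longrightarrow>
    f (x \<oplus>\<^bsub>N\<^esub> y) = f x \<oplus>\<^bsub>M\<^esub> f y"
  and linmap_smult: "linmap R N M f \<Longrightarrow> a \<in> carrier R \<Longrightarrow> x \<in> carrier N \<Longrightarrow>
    f (a \<odot>\<^bsub>N\<^esub> x) = a \<odot>\<^bsub>M\<^esub> f x"
  by (auto simp: linmap_def)

lemma linmap_zero:
  assumes "module R N" "module R M" "linmap R N M f"
  shows "f \<zero>\<^bsub>N\<^esub> = \<zero>\<^bsub>M\<^esub>"
proof -
  interpret N: module R N by fact
  interpret M: module R M by fact
  have "f (\<zero>\<^bsub>R\<^esub> \<odot>\<^bsub>N\<^esub> \<zero>\<^bsub>N\<^esub>) = \<zero>\<^bsub>R\<^esub> \<odot>\<^bsub>M\<^esub> f \<zero>\<^bsub>N\<^esub>"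
    by (rule linmap_smult[OF assms(3)]) simp_all
  then show ?thesis using linmap_closed[OF assms(3)] by simp
qed

lemma linmap_minus:
  assumes "module R N" "module R M" "linmap R N M f" "x \<in> carrier N" "y \<in> carrier N"
  shows "f (x \<ominus>\<^bsub>N\<^esub> y) = f x \<ominus>\<^bsub>M\<^esub> f y"
proof -
  interpret N: module R N by fact
  interpret M: module R M by fact
  have "f (x \<ominus>\<^bsub>N\<^esub> y) \<oplus>\<^bsub>M\<^esub> f y = f x"
    using linmap_add[OF assms(3), of "x \<ominus>\<^bsub>N\<^esub> y" y] assms(4,5)
    by (simp add: N.M.minus_eq N.M.a_assoc N.M.l_neg)
  then show ?thesis using linmap_closed[OF assms(3)] assms(4,5)
    by (metis M.M.add.inv_solve_right M.M.minus_eq N.M.minus_closed)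
qed

lemma linmap_id: "linmap R M M (\<lambda>x. x)"
  by (simp add: linmap_def)

lemma linmap_comp: "linmap R N M f \<Longrightarrow> linmap R M L g \<Longrightarrow> linmap R N L (\<lambda>x. g (f x))"
  by (simp add: linmap_def)

lemma linmap_cong:
  assumes "module R N" "\<And>x. x \<in> carrier N \<Longrightarrow> f x = g x" "linmap R N M f"
  shows "linmap R N M g"
proof -
  interpret N: module R N by fact
  show ?thesis using assms(3) by (simp add: linmap_def assms(2)[symmetric])
qed

lemma linmap_const_zero: "module R M \<Longrightarrow> linmap R N M (\<lambda>x. \<zero>\<^bsub>M\<^esub>)"
proof -
  assume "module R M"
  then interpret M: module R M .
  show ?thesis by (simp add: linmap_def)
qed

lemma linmap_plus:
  assumes "module R M" "linmap R N M f" "linmap R N M g"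
  shows "linmap R N M (\<lambda>x. f x \<oplus>\<^bsub>M\<^esub> g x)"
proof -
  interpret M: module R M by fact
  show ?thesis using assms(2,3)
    by (auto simp: linmap_def M.smult_r_distr M.M.add.m_ac)
qed

lemma linmap_scale:
  assumes "module R M" "linmap R N M f" "a \<in> carrier R"
  shows "linmap R N M (\<lambda>x. a \<odot>\<^bsub>M\<^esub> f x)"
proof -
  interpret M: module R M by fact
  show ?thesis using assms(2,3)
    by (auto simp: linmap_def M.smult_r_distr M.smult_assoc1[symmetric] M.R.m_comm)
qed

lemma linmap_diff:
  assumes "module R N" "module R M" "linmap R N M f" "linmap R N M g"
  shows "linmap R N M (\<lambda>x. f x \<ominus>\<^bsub>M\<^esub> g x)"
proof -
  interpret M: module R M by fact
  have 1: "linmap R N M (\<lambda>x. f x \<oplus>\<^bsub>M\<^esub> (\<ominus>\<^bsub>R\<^esub> \<one>\<^bsub>R\<^esub>) \<odot>\<^bsub>M\<^esub> g x)"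
    by (intro linmap_plus linmap_scale assms) simp
  have 2: "\<And>x. x \<in> carrier N \<Longrightarrow> f x \<oplus>\<^bsub>M\<^esub> (\<ominus>\<^bsub>R\<^esub> \<one>\<^bsub>R\<^esub>) \<odot>\<^bsub>M\<^esub> g x = f x \<ominus>\<^bsub>M\<^esub> g x"
    using linmap_closed[OF assms(4)] by (simp add: M.M.minus_eq M.smult_l_minus)
  show ?thesis by (rule linmap_cong[OF assms(1) 2 1])
qed

lemma linmap_submodule_iff:
  "linmap R N (M\<lparr>carrier := K\<rparr>) f \<longleftrightarrow> (\<forall>x\<in>carrier N. f x \<in> K) \<and>
    (\<forall>x\<in>carrier N. \<forall>y\<in>carrier N. f (x \<oplus>\<^bsub>N\<^esub> y) = f x \<oplus>\<^bsub>M\<^esub> f y) \<and>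
    (\<forall>a\<in>carrier R. \<forall>x\<in>carrier N. f (a \<odot>\<^bsub>N\<^esub> x) = a \<odot>\<^bsub>M\<^esub> f x)"
  by (simp add: linmap_def)

lemma mod_hom_iff:
  "f \<in> mod_hom R N M \<longleftrightarrow> linmap R N M f \<and> f \<in> extensional (carrier N)"
  by (auto simp: hom_module_def linmap_def PiE_def)

lemma restrict_mod_hom:
  assumes "module R N" "linmap R N M f"
  shows "restrict f (carrier N) \<in> mod_hom R N M"
proof -
  interpret N: module R N by fact
  show ?thesis using assms(2) by (auto simp: hom_module_def linmap_def)
qed

definition fmod :: "('r, 'a) ring_scheme \<Rightarrow> 'x set \<Rightarrow> ('r, 'x \<Rightarrow> 'r) module"
  where "fmod R S =
    \<lparr>carrier = {f. (\<forall>x. f x \<in> carrier R) \<and> (\<forall>x. x \<notin> S \<longrightarrow> f x = \<zero>\<^bsub>R\<^esub>) \<and> finite {x. f x \<noteq> \<zero>\<^bsub>R\<^esub>}},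
     mult = undefined, one = undefined, zero = (\<lambda>x. \<zero>\<^bsub>R\<^esub>), add = (\<lambda>f g x. f x \<oplus>\<^bsub>R\<^esub> g x),
     smult = (\<lambda>a f x. a \<otimes>\<^bsub>R\<^esub> f x)\<rparr>"

definition unit_vec :: "('r, 'a) ring_scheme \<Rightarrow> 'x \<Rightarrow> 'x \<Rightarrow> 'r"
  where "unit_vec R s = (\<lambda>x. if x = s then \<one>\<^bsub>R\<^esub> else \<zero>\<^bsub>R\<^esub>)"

text \<open>The sum runs over the support of \<open>f\<close> and does not mention the index set, so
  one map serves \<open>fmod R S\<close> and \<open>fmod R (S - {x})\<close> alike.\<close>

definition lincomb ::
  "('r, 'a) ring_scheme \<Rightarrow> ('r, 'm, 'b) module_scheme \<Rightarrow> ('x \<Rightarrow> 'm) \<Rightarrow> ('x \<Rightarrow> 'r) \<Rightarrow> 'm"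
  where "lincomb R M v f = (\<Oplus>\<^bsub>M\<^esub>s\<in>{s. f s \<noteq> \<zero>\<^bsub>R\<^esub>}. f s \<odot>\<^bsub>M\<^esub> v s)"

context cring
begin

lemma module_fmod: "module R (fmod R S)"
proof (rule moduleI[OF is_cring])
  show "abelian_group (fmod R S)"
  proof (rule abelian_groupI, goal_cases)
    case (1 x y)
    then have "{s. x s \<oplus> y s \<noteq> \<zero>} \<subseteq> {s. x s \<noteq> \<zero>} \<union> {s. y s \<noteq> \<zero>}" by (auto simp: fmod_def)
    with 1 show ?case by (auto simp: fmod_def intro: finite_subset)
  next
    case (6 x)
    have "(\<lambda>s. \<ominus> x s) \<in> carrier (fmod R S)"
    proof -
      have "{s. \<ominus> x s \<noteq> \<zero>} \<subseteq> {s. x s \<noteq> \<zero>}" by auto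
      with 6 show ?thesis by (auto simp: fmod_def intro: finite_subset)
    qed
    moreover have "(\<lambda>s. \<ominus> x s) \<oplus>\<^bsub>fmod R S\<^esub> x = \<zero>\<^bsub>fmod R S\<^esub>" using 6 by (auto simp: fmod_def l_neg)
    ultimately show ?case by blast
  qed (auto simp: fmod_def a_ac fun_eq_iff)
next
  fix a x assume "a \<in> carrier R" "x \<in> carrier (fmod R S)"
  moreover from this have "{s. a \<otimes> x s \<noteq> \<zero>} \<subseteq> {s. x s \<noteq> \<zero>}" by auto
  ultimately show "a \<odot>\<^bsub>fmod R S\<^esub> x \<in> carrier (fmod R S)"
    by (auto simp: fmod_def intro: finite_subset)
qed (auto simp: fmod_def l_distr r_distr m_assoc)

lemma fmod_simps:
  "\<zero>\<^bsub>fmod R S\<^esub> = (\<lambda>x. \<zero>)" "(f \<oplus>\<^bsub>fmod R S\<^esub> g) = (\<lambda>x. f x \<oplus> g x)"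
  "a \<odot>\<^bsub>fmod R S\<^esub> f = (\<lambda>x. a \<otimes> f x)"
  by (auto simp: fmod_def)

lemma fmod_carrier_finite:
  "finite S \<Longrightarrow> f \<in> carrier (fmod R S) \<longleftrightarrow> (\<forall>x. f x \<in> carrier R) \<and> (\<forall>x. x \<notin> S \<longrightarrow> f x = \<zero>)"
  by (auto simp: fmod_def intro: finite_subset[of _ S])

lemma fmodD: "f \<in> carrier (fmod R S) \<Longrightarrow> f x \<in> carrier R"
  "f \<in> carrier (fmod R S) \<Longrightarrow> x \<notin> S \<Longrightarrow> f x = \<zero>"
  "f \<in> carrier (fmod R S) \<Longrightarrow> finite {x. f x \<noteq> \<zero>}"
  by (auto simp: fmod_def)

lemma fmod_minus:
  assumes "f \<in> carrier (fmod R S)" "g \<in> carrier (fmod R S)"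
  shows "f \<ominus>\<^bsub>fmod R S\<^esub> g = (\<lambda>x. f x \<ominus> g x)"
proof -
  interpret F: module R "fmod R S" by (rule module_fmod)
  define h where "h = (\<lambda>x. f x \<ominus> g x)"
  have "{x. h x \<noteq> \<zero>} \<subseteq> {s. f s \<noteq> \<zero>} \<union> {s. g s \<noteq> \<zero>}" by (auto simp: minus_eq h_def)
  then have h: "h \<in> carrier (fmod R S)"
    using assms by (auto simp: fmod_def minus_eq h_def intro: finite_subset)
  have "h \<oplus>\<^bsub>fmod R S\<^esub> g = f"
    using assms by (auto simp: h_def fmod_simps minus_eq a_assoc l_neg fmodD)
  then have "f \<ominus>\<^bsub>fmod R S\<^esub> g = (h \<oplus>\<^bsub>fmod R S\<^esub> g) \<ominus>\<^bsub>fmod R S\<^esub> g" by simp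
  also have "\<dots> = h" using h assms(2) by (simp only: F.M.minus_eq F.M.a_assoc F.M.r_neg F.M.a_inv_closed F.M.r_zero)
  finally show ?thesis by (simp add: h_def)
qed

lemma unit_vec_closed: "s \<in> S \<Longrightarrow> unit_vec R s \<in> carrier (fmod R S)"
proof -
  have "{x. (if x = s then \<one> else \<zero>) \<noteq> \<zero>} \<subseteq> {s}" by auto
  then show "s \<in> S \<Longrightarrow> ?thesis"
    by (auto simp: fmod_def unit_vec_def intro: finite_subset)
qed

lemma lincomb_eq:
  assumes "module R M" "v \<in> S \<rightarrow> carrier M" "f \<in> carrier (fmod R S)"
    and "finite T" "{s. f s \<noteq> \<zero>} \<subseteq> T" "T \<subseteq> S"
  shows "lincomb R M v f = (\<Oplus>\<^bsub>M\<^esub>s\<in>T. f s \<odot>\<^bsub>M\<^esub> v s)"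
proof -
  interpret M: module R M by fact
  show ?thesis unfolding lincomb_def
    by (rule M.M.add.finprod_mono_neutral_cong_left)
      (use assms in \<open>auto simp: Pi_iff fmodD subset_iff\<close>)
qed

lemma lincomb_unit_vec:
  assumes "module R M" "v \<in> S \<rightarrow> carrier M" "s \<in> S"
  shows "lincomb R M v (unit_vec R s) = v s"
proof -
  interpret M: module R M by fact
  have "lincomb R M v (unit_vec R s) = (\<Oplus>\<^bsub>M\<^esub>t\<in>{s}. unit_vec R s t \<odot>\<^bsub>M\<^esub> v t)"
    by (rule lincomb_eq[OF assms(1,2) unit_vec_closed[OF assms(3)]])
      (use assms(3) in \<open>auto simp: unit_vec_def\<close>)
  also have "\<dots> = v s"
    using assms by (subst M.M.finsum_insert) (auto simp: unit_vec_def Pi_iff)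
  finally show ?thesis .
qed

lemma linmap_lincomb:
  assumes "module R M" "v \<in> S \<rightarrow> carrier M"
  shows "linmap R (fmod R S) M (lincomb R M v)"
proof -
  interpret M: module R M by fact
  interpret F: module R "fmod R S" by (rule module_fmod)
  have vM: "s \<in> S \<Longrightarrow> v s \<in> carrier M" for s using assms(2) by auto
  have supp: "finite {s. f s \<noteq> \<zero>}" "{s. f s \<noteq> \<zero>} \<subseteq> S" if "f \<in> carrier (fmod R S)" for f
    using that by (auto simp: fmod_def)
  have cl: "lincomb R M v f \<in> carrier M" if f: "f \<in> carrier (fmod R S)" for f
    unfolding lincomb_def
    by (rule M.M.finsum_closed) (use supp[OF f] f vM in \<open>auto simp: fmodD\<close>)
  have ad: "lincomb R M v (f \<oplus>\<^bsub>fmod R S\<^esub> g) = lincomb R M v f \<oplus>\<^bsub>M\<^esub> lincomb R M v g"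
    if f: "f \<in> carrier (fmod R S)" and g: "g \<in> carrier (fmod R S)" for f g
  proof -
    define T where "T = {s. f s \<noteq> \<zero>} \<union> {s. g s \<noteq> \<zero>}"
    have T: "finite T" "T \<subseteq> S" using supp[OF f] supp[OF g] by (auto simp: T_def)
    have "lincomb R M v (f \<oplus>\<^bsub>fmod R S\<^esub> g)
      = (\<Oplus>\<^bsub>M\<^esub>s\<in>T. (f \<oplus>\<^bsub>fmod R S\<^esub> g) s \<odot>\<^bsub>M\<^esub> v s)"
      by (rule lincomb_eq[OF assms F.M.a_closed[OF f g] T(1) _ T(2)]) (auto simp: T_def fmod_simps)
    also have "\<dots> = (\<Oplus>\<^bsub>M\<^esub>s\<in>T. f s \<odot>\<^bsub>M\<^esub> v s \<oplus>\<^bsub>M\<^esub> g s \<odot>\<^bsub>M\<^esub> v s)"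
      by (rule M.M.finsum_cong')
        (use T vM f g in \<open>auto simp: fmod_simps M.smult_l_distr fmodD subset_iff\<close>)
    also have "\<dots> = (\<Oplus>\<^bsub>M\<^esub>s\<in>T. f s \<odot>\<^bsub>M\<^esub> v s) \<oplus>\<^bsub>M\<^esub> (\<Oplus>\<^bsub>M\<^esub>s\<in>T. g s \<odot>\<^bsub>M\<^esub> v s)"
      by (rule M.M.finsum_addf) (use T vM f g in \<open>auto simp: fmodD subset_iff\<close>)
    also have "(\<Oplus>\<^bsub>M\<^esub>s\<in>T. f s \<odot>\<^bsub>M\<^esub> v s) = lincomb R M v f"
      by (rule lincomb_eq[symmetric]) (use assms T f in \<open>auto simp: T_def\<close>)
    also have "(\<Oplus>\<^bsub>M\<^esub>s\<in>T. g s \<odot>\<^bsub>M\<^esub> v s) = lincomb R M v g"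
      by (rule lincomb_eq[symmetric]) (use assms T g in \<open>auto simp: T_def\<close>)
    finally show ?thesis .
  qed
  have sm: "lincomb R M v (a \<odot>\<^bsub>fmod R S\<^esub> f) = a \<odot>\<^bsub>M\<^esub> lincomb R M v f"
    if f: "f \<in> carrier (fmod R S)" and a: "a \<in> carrier R" for f a
  proof -
    define T where "T = {s. f s \<noteq> \<zero>}"
    have T: "finite T" "T \<subseteq> S" using supp[OF f] by (auto simp: T_def)
    have "lincomb R M v (a \<odot>\<^bsub>fmod R S\<^esub> f) = (\<Oplus>\<^bsub>M\<^esub>s\<in>T. (a \<odot>\<^bsub>fmod R S\<^esub> f) s \<odot>\<^bsub>M\<^esub> v s)"
      by (rule lincomb_eq[OF assms F.smult_closed[OF a f] T(1) _ T(2)])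
        (use a in \<open>auto simp: T_def fmod_simps\<close>)
    also have "\<dots> = (\<Oplus>\<^bsub>M\<^esub>s\<in>T. a \<odot>\<^bsub>M\<^esub> (f s \<odot>\<^bsub>M\<^esub> v s))"
      by (rule M.M.finsum_cong')
        (use T vM f a in \<open>auto simp: fmod_simps M.smult_assoc1 fmodD subset_iff\<close>)
    also have "\<dots> = a \<odot>\<^bsub>M\<^esub> (\<Oplus>\<^bsub>M\<^esub>s\<in>T. f s \<odot>\<^bsub>M\<^esub> v s)"
      by (rule M.finsum_smult_ldistr[symmetric])
        (use T vM f a in \<open>auto simp: fmodD subset_iff\<close>)
    also have "(\<Oplus>\<^bsub>M\<^esub>s\<in>T. f s \<odot>\<^bsub>M\<^esub> v s) = lincomb R M v f"
      by (rule lincomb_eq[symmetric]) (use assms T f in \<open>auto simp: T_def\<close>)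
    finally show ?thesis .
  qed
  show ?thesis unfolding linmap_def using cl ad sm by blast
qed

text \<open>\<open>I\<close> records where the coefficients lie: \<open>carrier R\<close> gives
  ordinary induction over vectors, the maximal ideal gives induction over vectors with all
  coordinates in it, as in \<open>linmap_fmod_max\<close>.\<close>

lemma fmod_induct [consumes 2, case_names zero step]:
  assumes "f \<in> carrier (fmod R S)" and "\<And>x. f x \<in> I"
    and zero: "P (\<lambda>x. \<zero>)"
    and step: "\<And>g s a. g \<in> carrier (fmod R S) \<Longrightarrow> P g \<Longrightarrow> s \<in> S \<Longrightarrow> a \<in> I \<Longrightarrow> a \<in> carrier R \<Longrightarrow>
      P (a \<odot>\<^bsub>fmod R S\<^esub> unit_vec R s \<oplus>\<^bsub>fmod R S\<^esub> g)"
  shows "P f"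
proof -
  \<comment> \<open>Membership in \<open>I\<close> is asked of nonzero coordinates only, since
    clearing a coordinate puts \<zero> there and \<open>I\<close> is an arbitrary set.\<close>
  have "P f" if "finite T" "f \<in> carrier (fmod R S)" "{x. f x \<noteq> \<zero>} = T"
    "\<forall>x. f x \<noteq> \<zero> \<longrightarrow> f x \<in> I" for T f
    using that
  proof (induction T arbitrary: f rule: finite_induct)
    case empty
    then have "f = (\<lambda>x. \<zero>)" by (auto simp: fun_eq_iff)
    with zero show ?case by simp
  next
    case (insert s T)
    define g where "g = f(s := \<zero>)"
    have g: "{x. g x \<noteq> \<zero>} = T" using insert by (auto simp: g_def)
    have "g \<in> carrier (fmod R S)" using insert.prems(1) insert.hyps(1) g
      by (auto simp: fmod_def g_def)
    moreover have "\<forall>x. g x \<noteq> \<zero> \<longrightarrow> g x \<in> I" using insert.prems by (auto simp: g_def)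
    ultimately have gP: "g \<in> carrier (fmod R S)" "P g" using insert.IH[of g] g by auto
    have s: "f s \<noteq> \<zero>" using insert.prems(2) by auto
    then have "P (f s \<odot>\<^bsub>fmod R S\<^esub> unit_vec R s \<oplus>\<^bsub>fmod R S\<^esub> g)"
      using insert.prems by (intro step gP) (auto simp: fmodD intro: ccontr[of "s \<in> S"])
    also have "f s \<odot>\<^bsub>fmod R S\<^esub> unit_vec R s \<oplus>\<^bsub>fmod R S\<^esub> g = f"
      using insert.prems(1) by (auto simp: fmod_simps g_def unit_vec_def fun_eq_iff fmodD)
    finally show ?case .
  qed
  from this[of "{x. f x \<noteq> \<zero>}" f] show ?thesis using assms(1,2) by (auto simp: fmodD)
qed

lemma linmap_fmod_eqI:
  assumes "module R M" "linmap R (fmod R S) M g" "linmap R (fmod R S) M h"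
    and "\<And>s. s \<in> S \<Longrightarrow> g (unit_vec R s) = h (unit_vec R s)"
    and "f \<in> carrier (fmod R S)"
  shows "g f = h f"
proof -
  interpret M: module R M by fact
  interpret F: module R "fmod R S" by (rule module_fmod)
  have z: "(\<lambda>x. \<zero>) = \<zero>\<^bsub>fmod R S\<^esub>" by (simp add: fmod_simps)
  show ?thesis using assms(5) fmodD(1)[OF assms(5)]
  proof (induction f rule: fmod_induct)
    case zero
    show ?case unfolding z using assms by (simp add: linmap_zero[OF F.module_axioms])
  next
    case (step f s a)
    then show ?case using assms(2-4)
      by (simp add: linmap_add[OF assms(2)] linmap_add[OF assms(3)] linmap_smult[OF assms(2)]
        linmap_smult[OF assms(3)] unit_vec_closed)
  qed
qed

lemma proj_lift:
  fixes P :: "('a, 'p) module" and N :: "('a, 'n, 'e) module_scheme"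
    and L :: "('a, 'l, 'f) module_scheme"
  assumes "projective_module R P" "module R N" "module R L" "linmap R N L g" "linmap R P L f"
    and "f ` carrier P \<subseteq> g ` carrier N"
  shows "\<exists>h. linmap R P N h \<and> (\<forall>x\<in>carrier P. g (h x) = f x)"
  \<comment> \<open>The test modules may have any element type: a section of the free module on \<open>carrier P\<close>
    exists by definition, and that module maps to any \<open>N\<close>.\<close>
proof -
  have P: "module R P" using assms(1) by (simp add: projective_module_def)
  interpret P: module R P by fact
  interpret N: module R N by fact
  interpret L: module R L by fact
  let ?F = "fmod R (carrier P) :: ('a, 'p \<Rightarrow> 'a) module"
  interpret F: module R ?F by (rule module_fmod)
  let ?\<pi> = "lincomb R P (\<lambda>x. x)"
  have pi: "linmap R ?F P ?\<pi>" by (rule linmap_lincomb[OF P]) auto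
  have surj: "restrict ?\<pi> (carrier ?F) ` carrier ?F = carrier P"
  proof
    show "carrier P \<subseteq> restrict ?\<pi> (carrier ?F) ` carrier ?F"
    proof
      fix x assume x: "x \<in> carrier P"
      show "x \<in> restrict ?\<pi> (carrier ?F) ` carrier ?F"
        using lincomb_unit_vec[OF P _ x, of "\<lambda>x. x"] unit_vec_closed[OF x]
        by (intro image_eqI[of _ _ "unit_vec R x"]) auto
    qed
  qed (use linmap_closed[OF pi] in auto)
  have "\<exists>h\<in>mod_hom R P ?F. \<forall>x\<in>carrier P.
      restrict ?\<pi> (carrier ?F) (h x) = restrict (\<lambda>x. x) (carrier P) x"
    using assms(1) P F.module_axioms surj restrict_mod_hom[OF F.module_axioms pi]
      restrict_mod_hom[OF P linmap_id] unfolding projective_module_def by blast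
  then obtain s where s: "linmap R P ?F s" "\<forall>x\<in>carrier P. ?\<pi> (s x) = x"
    by (auto simp: mod_hom_iff linmap_def)
  have "\<forall>x\<in>carrier P. \<exists>y\<in>carrier N. g y = f x"
  proof
    fix x assume "x \<in> carrier P"
    then have "f x \<in> g ` carrier N" using assms(6) by blast
    then show "\<exists>y\<in>carrier N. g y = f x" by (auto simp: image_iff)
  qed
  then obtain n where n: "\<forall>x\<in>carrier P. n x \<in> carrier N \<and> g (n x) = f x" by metis
  let ?k = "lincomb R N n"
  have k: "linmap R ?F N ?k" by (rule linmap_lincomb) (use n assms in auto)
  \<comment> \<open>On the free module \<open>?k\<close> lifts f composed with
    \<open>?\<pi>\<close>, as seen on the basis; composing with the section \<open>s\<close> of
    \<open>?\<pi>\<close> then leaves a lift of f.\<close>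
  have "g (?k y) = f (?\<pi> y)" if "y \<in> carrier ?F" for y
  proof (rule linmap_fmod_eqI[where g = "\<lambda>y. g (?k y)" and h = "\<lambda>y. f (?\<pi> y)", OF assms(3) _ _ _ that])
    show "linmap R ?F L (\<lambda>y. g (?k y))" by (rule linmap_comp[OF k assms(4)])
    show "linmap R ?F L (\<lambda>y. f (?\<pi> y))" by (rule linmap_comp[OF pi assms(5)])
    fix x assume x: "x \<in> carrier P"
    have "?k (unit_vec R x) = n x" using n by (intro lincomb_unit_vec[OF assms(2) _ x]) auto
    moreover have "?\<pi> (unit_vec R x) = x" by (intro lincomb_unit_vec[OF P _ x]) auto
    ultimately show "g (?k (unit_vec R x)) = f (?\<pi> (unit_vec R x))" using n x by simp
  qed
  then have "\<forall>x\<in>carrier P. g (?k (s x)) = f x"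
    using s by (auto simp: linmap_def)
  then show ?thesis using linmap_comp[OF s(1) k] by blast
qed

lemma projective_fmod:
  fixes S :: "'x set"
  shows "projective_module R (fmod R S)"
  unfolding projective_module_def
proof (intro conjI allI ballI impI)
  let ?F = "fmod R S"
  interpret F: module R ?F by (rule module_fmod)
  show "module R ?F" by (rule module_fmod)
  fix N :: "('a, ('x \<Rightarrow> 'a) \<Rightarrow> 'a) module" and L :: "('a, 'x \<Rightarrow> 'a) module" and g f
  assume g: "g \<in> mod_hom R N L" and f: "f \<in> mod_hom R ?F L"
    and "module R N \<and> module R L \<and> g ` carrier N = carrier L"
  then have N: "module R N" and L: "module R L" and gs: "g ` carrier N = carrier L" by auto
  have "\<forall>s\<in>S. \<exists>y\<in>carrier N. g y = f (unit_vec R s)"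
  proof
    fix s assume "s \<in> S"
    then have "f (unit_vec R s) \<in> g ` carrier N"
      using f gs unit_vec_closed[of s S] by (auto simp: mod_hom_iff linmap_def)
    then show "\<exists>y\<in>carrier N. g y = f (unit_vec R s)" by (auto simp: image_iff)
  qed
  then obtain n where n: "\<forall>s\<in>S. n s \<in> carrier N \<and> g (n s) = f (unit_vec R s)" by metis
  let ?k = "lincomb R N n"
  have k: "linmap R ?F N ?k" by (rule linmap_lincomb) (use n N in auto)
  have "g (?k y) = f y" if y: "y \<in> carrier ?F" for y
  proof (rule linmap_fmod_eqI[where g = "\<lambda>y. g (?k y)" and h = f, OF L _ _ _ y])
    show "linmap R ?F L (\<lambda>y. g (?k y))" using g by (intro linmap_comp[OF k]) (simp add: mod_hom_iff)
    show "linmap R ?F L f" using f by (simp add: mod_hom_iff)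
    fix s assume s: "s \<in> S"
    have "?k (unit_vec R s) = n s" using n by (intro lincomb_unit_vec[OF N _ s]) auto
    then show "g (?k (unit_vec R s)) = f (unit_vec R s)" using n s by simp
  qed
  then show "\<exists>h\<in>mod_hom R ?F N. \<forall>x\<in>carrier ?F. g (h x) = f x"
    by (intro bexI[OF _ restrict_mod_hom[OF F.module_axioms k]]) simp
qed

end

section \<open>Projective complexes and cohomology\<close>

lemma (in abelian_group) minus_self [simp]: "x \<in> carrier G \<Longrightarrow> x \<ominus> x = \<zero>"
  by (simp add: minus_eq r_neg)

lemma (in abelian_group) minus_zero_right [simp]: "x \<in> carrier G \<Longrightarrow> x \<ominus> \<zero> = x"
  by (simp add: minus_eq)

text \<open>Exactness enters as a hypothesis on the target of the lifting lemmas below. Maps are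
  given by \<open>linmap\<close>, so lifts and homotopies can be composed without restricting them
  to carriers.\<close>

locale projective_complex = cring R for R (structure) +
  fixes P :: "nat \<Rightarrow> ('a, 'p) module" and d :: "nat \<Rightarrow> 'p \<Rightarrow> 'p"
  assumes projective: "projective_module R (P i)"
    and linmap_d: "linmap R (P (Suc i)) (P i) (d i)"
    and d_d: "x \<in> carrier (P (Suc (Suc i))) \<Longrightarrow> d i (d (Suc i) x) = \<zero>\<^bsub>P i\<^esub>"
begin

lemma module_P: "module R (P i)"
  using projective[of i] by (simp add: projective_module_def)

lemma d_closed: "x \<in> carrier (P (Suc i)) \<Longrightarrow> d i x \<in> carrier (P i)"
  by (rule linmap_closed[OF linmap_d])

lemma linmap_comp_d: "linmap R (P i) A z \<Longrightarrow> linmap R (P (Suc i)) A (\<lambda>x. z (d i x))"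
  by (rule linmap_comp[OF linmap_d])

text \<open>Serves two purposes: on a minimal resolution, for a composite of comparison maps minus
  the identity, and on a resolution of the residue field, for multiplication by an element of \<mm>.
  The homotopy is built degree by degree, lifting \<phi> - h d along d' by exactness of the
  target.\<close>

lemma null_homotopy:
  fixes Q :: "nat \<Rightarrow> ('a, 'q, 'e) module_scheme"
  assumes Q: "\<And>i. module R (Q i)" and d': "\<And>i. linmap R (Q (Suc i)) (Q i) (d' i)"
    and exact: "\<And>i. {y \<in> carrier (Q (Suc i)). d' i y = \<zero>\<^bsub>Q i\<^esub>}
      \<subseteq> d' (Suc i) ` carrier (Q (Suc (Suc i)))"
    and \<phi>: "\<And>i. linmap R (P i) (Q i) (\<phi> i)"
    and chain: "\<And>i x. x \<in> carrier (P (Suc i)) \<Longrightarrow> d' i (\<phi> (Suc i) x) = \<phi> i (d i x)"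
    and \<phi>0: "\<phi> 0 ` carrier (P 0) \<subseteq> d' 0 ` carrier (Q 1)"
  shows "\<exists>h. (\<forall>i. linmap R (P i) (Q (Suc i)) (h i)) \<and>
    (\<forall>x\<in>carrier (P 0). d' 0 (h 0 x) = \<phi> 0 x) \<and>
    (\<forall>i. \<forall>x\<in>carrier (P (Suc i)). d' (Suc i) (h (Suc i) x) = \<phi> (Suc i) x \<ominus>\<^bsub>Q (Suc i)\<^esub> h i (d i x))"
proof -
  \<comment> \<open>The invariant speaks about the current h alone: it says that \<phi> - h d will
    consist of cycles in the next degree, and it follows from the homotopy equation and d d = 0. The
    clause for \<open>n = 0\<close> fixes the start, which \<open>dependent_nat_choice\<close> would
    not record.\<close>
  define I where "I n h \<longleftrightarrow> linmap R (P n) (Q (Suc n)) h \<and>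
    (\<forall>x\<in>carrier (P (Suc n)). d' n (h (d n x)) = \<phi> n (d n x)) \<and>
    (n = 0 \<longrightarrow> (\<forall>x\<in>carrier (P 0). d' 0 (h x) = \<phi> 0 x))" for n h
  have "\<exists>h. \<forall>n. I n (h n) \<and> (\<forall>x\<in>carrier (P (Suc n)).
      d' (Suc n) (h (Suc n) x) = \<phi> (Suc n) x \<ominus>\<^bsub>Q (Suc n)\<^esub> h n (d n x))"
  proof (rule dependent_nat_choice)
    obtain h where "linmap R (P 0) (Q 1) h" "\<forall>x\<in>carrier (P 0). d' 0 (h x) = \<phi> 0 x"
      using proj_lift[OF projective Q Q d'[of 0] \<phi>[of 0]] \<phi>0 by auto
    then show "\<exists>h. I 0 h" by (auto simp: I_def d_closed)
  next
    fix h n assume h: "I n h"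
    interpret Q: module R "Q (Suc n)" by (rule Q)
    interpret Qn: module R "Q n" by (rule Q)
    have hl: "linmap R (P n) (Q (Suc n)) h" using h by (simp add: I_def)
    let ?\<psi> = "\<lambda>x. \<phi> (Suc n) x \<ominus>\<^bsub>Q (Suc n)\<^esub> h (d n x)"
    have \<psi>: "linmap R (P (Suc n)) (Q (Suc n)) ?\<psi>"
      by (intro linmap_diff \<phi> module_P Q linmap_comp_d hl)
    have "?\<psi> ` carrier (P (Suc n)) \<subseteq> d' (Suc n) ` carrier (Q (Suc (Suc n)))"
    proof (rule subset_trans[OF _ exact], safe)
      fix x assume x: "x \<in> carrier (P (Suc n))"
      show "?\<psi> x \<in> carrier (Q (Suc n))" by (rule linmap_closed[OF \<psi> x])
      have "d' n (?\<psi> x) = d' n (\<phi> (Suc n) x) \<ominus>\<^bsub>Q n\<^esub> d' n (h (d n x))"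
        using x by (intro linmap_minus[OF Q Q d'])
          (auto intro: linmap_closed[OF \<phi>] linmap_closed[OF hl] d_closed)
      also have "\<dots> = \<zero>\<^bsub>Q n\<^esub>"
        using h x linmap_closed[OF \<phi> d_closed[OF x]] by (simp add: I_def chain)
      finally show "d' n (?\<psi> x) = \<zero>\<^bsub>Q n\<^esub>" .
    qed
    then obtain k where k: "linmap R (P (Suc n)) (Q (Suc (Suc n))) k"
        "\<forall>x\<in>carrier (P (Suc n)). d' (Suc n) (k x) = ?\<psi> x"
      using proj_lift[OF projective Q Q d' \<psi>] by blast
    have "d' (Suc n) (k (d (Suc n) x)) = \<phi> (Suc n) (d (Suc n) x)"
      if "x \<in> carrier (P (Suc (Suc n)))" for x
      using k(2) that linmap_closed[OF \<phi> d_closed[OF that]]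
      by (simp add: d_closed d_d linmap_zero[OF module_P Q hl])
    with k show "\<exists>k. I (Suc n) k \<and> (\<forall>x\<in>carrier (P (Suc n)). d' (Suc n) (k x) = ?\<psi> x)"
      unfolding I_def by blast
  qed
  then obtain h where "\<forall>n. I n (h n) \<and> (\<forall>x\<in>carrier (P (Suc n)).
      d' (Suc n) (h (Suc n) x) = \<phi> (Suc n) x \<ominus>\<^bsub>Q (Suc n)\<^esub> h n (d n x))" ..
  then show ?thesis by (intro exI[of _ h]) (simp add: I_def)
qed

text \<open>The comparison theorem of homological algebra: projective terms in the source, exactness
  in the target. It is applied in both directions between two resolutions of one module.\<close>

lemma chain_map_lift:
  fixes Q :: "nat \<Rightarrow> ('a, 'q, 'e) module_scheme" and N :: "('a, 'n, 'f) module_scheme"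
  assumes N: "module R N" and e: "linmap R (P 0) N e"
    and ed: "\<And>x. x \<in> carrier (P 1) \<Longrightarrow> e (d 0 x) = \<zero>\<^bsub>N\<^esub>"
    and Q: "\<And>i. module R (Q i)" and d': "\<And>i. linmap R (Q (Suc i)) (Q i) (d' i)"
    and e': "linmap R (Q 0) N e'" "e' ` carrier (Q 0) = carrier N"
    and exact0: "{y \<in> carrier (Q 0). e' y = \<zero>\<^bsub>N\<^esub>} \<subseteq> d' 0 ` carrier (Q 1)"
    and exact: "\<And>i. {y \<in> carrier (Q (Suc i)). d' i y = \<zero>\<^bsub>Q i\<^esub>}
      \<subseteq> d' (Suc i) ` carrier (Q (Suc (Suc i)))"
  shows "\<exists>\<phi>. (\<forall>i. linmap R (P i) (Q i) (\<phi> i)) \<and> (\<forall>x\<in>carrier (P 0). e' (\<phi> 0 x) = e x) \<and>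
    (\<forall>i. \<forall>x\<in>carrier (P (Suc i)). d' i (\<phi> (Suc i) x) = \<phi> i (d i x))"
proof -
  \<comment> \<open>The middle clause is the hypothesis under which \<open>proj_lift\<close>
    produces the next map.\<close>
  define I where "I n \<phi> \<longleftrightarrow> linmap R (P n) (Q n) \<phi> \<and>
    (\<forall>x\<in>carrier (P (Suc n)). \<phi> (d n x) \<in> d' n ` carrier (Q (Suc n))) \<and>
    (n = 0 \<longrightarrow> (\<forall>x\<in>carrier (P 0). e' (\<phi> x) = e x))" for n \<phi>
  have "\<exists>\<phi>. \<forall>n. I n (\<phi> n) \<and>
      (\<forall>x\<in>carrier (P (Suc n)). d' n (\<phi> (Suc n) x) = \<phi> n (d n x))"
  proof (rule dependent_nat_choice)
    have "e ` carrier (P 0) \<subseteq> e' ` carrier (Q 0)" using linmap_closed[OF e] e'(2) by auto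
    then obtain \<phi> where \<phi>: "linmap R (P 0) (Q 0) \<phi>" "\<forall>x\<in>carrier (P 0). e' (\<phi> x) = e x"
      using proj_lift[OF projective Q N e'(1) e] by blast
    have "\<phi> (d 0 x) \<in> d' 0 ` carrier (Q 1)" if "x \<in> carrier (P 1)" for x
      using exact0 \<phi> ed[OF that] d_closed[of x 0] linmap_closed[OF \<phi>(1)] that by auto
    with \<phi> show "\<exists>\<phi>. I 0 \<phi>" by (auto simp: I_def)
  next
    fix \<phi> n assume \<phi>: "I n \<phi>"
    then have \<phi>l: "linmap R (P n) (Q n) \<phi>" by (simp add: I_def)
    have "(\<lambda>x. \<phi> (d n x)) ` carrier (P (Suc n)) \<subseteq> d' n ` carrier (Q (Suc n))"
      using \<phi> by (auto simp: I_def)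
    then obtain \<psi> where \<psi>: "linmap R (P (Suc n)) (Q (Suc n)) \<psi>"
        "\<forall>x\<in>carrier (P (Suc n)). d' n (\<psi> x) = \<phi> (d n x)"
      using proj_lift[OF projective Q Q d' linmap_comp_d[OF \<phi>l]] by blast
    have "\<psi> (d (Suc n) x) \<in> d' (Suc n) ` carrier (Q (Suc (Suc n)))"
      if "x \<in> carrier (P (Suc (Suc n)))" for x
    proof -
      have "d' n (\<psi> (d (Suc n) x)) = \<zero>\<^bsub>Q n\<^esub>"
        using \<psi>(2) that by (simp add: d_closed d_d linmap_zero[OF module_P Q \<phi>l])
      then show ?thesis using exact[of n] linmap_closed[OF \<psi>(1) d_closed[OF that]] by blast
    qed
    with \<psi> show "\<exists>\<psi>. I (Suc n) \<psi> \<and> (\<forall>x\<in>carrier (P (Suc n)). d' n (\<psi> x) = \<phi> (d n x))"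
      unfolding I_def by blast
  qed
  then obtain \<phi> where "\<forall>n. I n (\<phi> n) \<and>
      (\<forall>x\<in>carrier (P (Suc n)). d' n (\<phi> (Suc n) x) = \<phi> n (d n x))" ..
  then show ?thesis by (intro exI[of _ \<phi>]) (simp add: I_def)
qed

section \<open>Cocycles, coboundaries and vanishing cohomology\<close>

definition cocycle :: "('a, 'm, 'c) module_scheme \<Rightarrow> nat \<Rightarrow> ('p \<Rightarrow> 'm) \<Rightarrow> bool"
  where "cocycle A i z \<longleftrightarrow>
    linmap R (P i) A z \<and> (\<forall>x\<in>carrier (P (Suc i)). z (d i x) = \<zero>\<^bsub>A\<^esub>)"

text \<open>In degree 0 only zero bounds, the complex being continued by zero.\<close>

definition coboundary :: "('a, 'm, 'c) module_scheme \<Rightarrow> nat \<Rightarrow> ('p \<Rightarrow> 'm) \<Rightarrow> bool"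
  where "coboundary A i z \<longleftrightarrow>
    (case i of 0 \<Rightarrow> \<forall>x\<in>carrier (P 0). z x = \<zero>\<^bsub>A\<^esub>
     | Suc j \<Rightarrow> \<exists>w. linmap R (P j) A w \<and> (\<forall>x\<in>carrier (P i). z x = w (d j x)))"

text \<open>If P is a projective resolution of N, this is Ext^i(N, A) = 0.\<close>

definition vanishes :: "('a, 'm, 'c) module_scheme \<Rightarrow> nat \<Rightarrow> bool"
  where "vanishes A i \<longleftrightarrow> (\<forall>z. cocycle A i z \<longrightarrow> coboundary A i z)"

lemma coboundary_0: "coboundary A 0 z \<longleftrightarrow> (\<forall>x\<in>carrier (P 0). z x = \<zero>\<^bsub>A\<^esub>)"
  and coboundary_Suc: "coboundary A (Suc j) z \<longleftrightarrow>
    (\<exists>w. linmap R (P j) A w \<and> (\<forall>x\<in>carrier (P (Suc j)). z x = w (d j x)))"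
  by (simp_all add: coboundary_def)

lemma coboundary_cong:
  "coboundary A i z \<Longrightarrow> (\<And>x. x \<in> carrier (P i) \<Longrightarrow> z x = y x) \<Longrightarrow> coboundary A i y"
  by (cases i) (auto simp: coboundary_0 coboundary_Suc)

lemma cocycle_comp:
  assumes "module R A" "module R B" "linmap R A B f" "cocycle A i z"
  shows "cocycle B i (\<lambda>x. f (z x))"
  using assms linmap_comp[of R "P i" A z B f] by (simp add: cocycle_def linmap_zero)

lemma coboundary_comp:
  assumes "module R A" "module R B" "linmap R A B f" "coboundary A i z"
  shows "coboundary B i (\<lambda>x. f (z x))"
proof (cases i)
  case 0
  with assms show ?thesis by (simp add: coboundary_0 linmap_zero)
next
  case (Suc j)
  with assms obtain w where "linmap R (P j) A w" "\<forall>x\<in>carrier (P i). z x = w (d j x)"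
    by (auto simp: coboundary_Suc)
  then show ?thesis using Suc linmap_comp[OF _ assms(3)]
    by (auto simp: coboundary_Suc intro!: exI[of _ "\<lambda>x. f (w x)"])
qed

lemma coboundary_zero: "module R A \<Longrightarrow> coboundary A i (\<lambda>x. \<zero>\<^bsub>A\<^esub>)"
  by (cases i) (auto simp: coboundary_0 coboundary_Suc intro!: exI[of _ "\<lambda>x. \<zero>\<^bsub>A\<^esub>"] linmap_const_zero)

lemma coboundary_plus:
  assumes A: "module R A" and y: "coboundary A i y" and z: "coboundary A i z"
  shows "coboundary A i (\<lambda>x. y x \<oplus>\<^bsub>A\<^esub> z x)"
proof (cases i)
  case 0
  interpret A: module R A by fact
  from 0 assms show ?thesis by (simp add: coboundary_0)
next
  case (Suc j)
  with y z obtain v w where "linmap R (P j) A w" "\<forall>x\<in>carrier (P i). z x = w (d j x)"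
      "linmap R (P j) A v" "\<forall>x\<in>carrier (P i). y x = v (d j x)"
    by (auto simp: coboundary_Suc)
  then show ?thesis using Suc linmap_plus[OF A, of "P j" v w]
    by (auto simp: coboundary_Suc intro!: exI[of _ "\<lambda>x. v x \<oplus>\<^bsub>A\<^esub> w x"])
qed

text \<open>A cocycle z of B equals f (g z), and g z bounds in A. This covers isomorphisms as well
  as direct summands.\<close>

lemma vanishes_retract:
  assumes "module R A" "module R B" "linmap R A B f" "linmap R B A g"
    and "\<And>y. y \<in> carrier B \<Longrightarrow> f (g y) = y" and "vanishes A i"
  shows "vanishes B i"
  unfolding vanishes_def
proof (intro allI impI)
  fix z assume z: "cocycle B i z"
  then have "coboundary A i (\<lambda>x. g (z x))"
    using assms cocycle_comp[of B A g i z] by (simp add: vanishes_def)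
  then have "coboundary B i (\<lambda>x. f (g (z x)))" by (rule coboundary_comp[OF assms(1-3)])
  then show "coboundary B i z"
    by (rule coboundary_cong) (use z assms(5) in \<open>auto simp: cocycle_def linmap_def\<close>)
qed

end

section \<open>Short exact sequences and the long exact sequence of Ext\<close>

definition short_exact where
  "short_exact R K F M \<phi> \<psi> \<longleftrightarrow> module R K \<and> module R F \<and> module R M \<and>
    linmap R K F \<phi> \<and> inj_on \<phi> (carrier K) \<and> linmap R F M \<psi> \<and> \<psi> ` carrier F = carrier M \<and>
    {x \<in> carrier F. \<psi> x = \<zero>\<^bsub>M\<^esub>} = \<phi> ` carrier K"

text \<open>Preimages under an injective map are unique, so the pointwise choice by
  \<open>inv_into\<close> is automatically linear.\<close>

lemma linmap_factor:
  assumes "module R X" "module R K" "linmap R K F \<phi>" "inj_on \<phi> (carrier K)" "linmap R X F f"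
    and "\<And>x. x \<in> carrier X \<Longrightarrow> f x \<in> \<phi> ` carrier K"
  shows "\<exists>u. linmap R X K u \<and> (\<forall>x\<in>carrier X. \<phi> (u x) = f x)"
proof -
  interpret X: module R X by fact
  interpret K: module R K by fact
  define u where "u x = inv_into (carrier K) \<phi> (f x)" for x
  have u: "u x \<in> carrier K" "\<phi> (u x) = f x" if "x \<in> carrier X" for x
    using assms(6)[OF that] by (auto simp: u_def inv_into_into f_inv_into_f)
  have eqI: "a = b" if "a \<in> carrier K" "b \<in> carrier K" "\<phi> a = \<phi> b" for a b
    using that assms(4) by (auto simp: inj_on_def)
  have "linmap R X K u" unfolding linmap_def
    by (intro conjI ballI u eqI)
      (auto simp: u linmap_add[OF assms(3)] linmap_add[OF assms(5)] linmap_smult[OF assms(3)]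
        linmap_smult[OF assms(5)])
  with u show ?thesis by blast
qed

context projective_complex
begin

context
  fixes K :: "('a, 'k, 'c) module_scheme" and F :: "('a, 'f, 'd) module_scheme"
    and M :: "('a, 'm, 'e) module_scheme" and \<phi> \<psi>
  assumes ses: "short_exact R K F M \<phi> \<psi>"
begin

lemma ses_simps: "module R K" "module R F" "module R M" "linmap R K F \<phi>" "inj_on \<phi> (carrier K)"
    "linmap R F M \<psi>" "\<psi> ` carrier F = carrier M" "{x \<in> carrier F. \<psi> x = \<zero>\<^bsub>M\<^esub>} = \<phi> ` carrier K"
  using ses by (auto simp: short_exact_def)

lemma ses_comp_zero: "x \<in> carrier K \<Longrightarrow> \<psi> (\<phi> x) = \<zero>\<^bsub>M\<^esub>"
  using ses_simps(8) by auto

lemma ses_factor: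
  assumes "linmap R (P i) F f" "\<And>x. x \<in> carrier (P i) \<Longrightarrow> \<psi> (f x) = \<zero>\<^bsub>M\<^esub>"
  shows "\<exists>u. linmap R (P i) K u \<and> (\<forall>x\<in>carrier (P i). \<phi> (u x) = f x)"
  by (rule linmap_factor[OF module_P ses_simps(1,4,5) assms(1)])
    (use ses_simps(8) assms linmap_closed[OF assms(1)] in blast)

text \<open>Here projectivity of \<open>P i\<close> enters the long exact sequence: Hom(P i, -)
  keeps \<psi> surjective.\<close>

lemma ses_lift:
  assumes "linmap R (P i) M f"
  shows "\<exists>u. linmap R (P i) F u \<and> (\<forall>x\<in>carrier (P i). \<psi> (u x) = f x)"
  by (rule proj_lift[OF projective ses_simps(2,3,6) assms])
    (use ses_simps(7) linmap_closed[OF assms] in blast)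

text \<open>Exactness at F: what bounds in M comes from K up to a coboundary of F. It is stated for
  maps y that may fail to be cocycles, as \<open>vanishes_kernel\<close> requires.\<close>

lemma coboundary_lift:
  assumes y: "linmap R (P i) F y" and "coboundary M i (\<lambda>x. \<psi> (y x))"
  shows "\<exists>v w. linmap R (P i) K w \<and> coboundary F i v \<and> linmap R (P i) F v \<and>
    (\<forall>x\<in>carrier (P i). y x = v x \<oplus>\<^bsub>F\<^esub> \<phi> (w x))"
proof -
  interpret F: module R F by (rule ses_simps)
  interpret M: module R M by (rule ses_simps)
  have "\<exists>v. coboundary F i v \<and> linmap R (P i) F v \<and> (\<forall>x\<in>carrier (P i). \<psi> (v x) = \<psi> (y x))"
  proof (cases i)
    case 0
    with assms show ?thesis
      by (auto simp: coboundary_0 linmap_zero[OF ses_simps(2,3,6)]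
        intro!: exI[of _ "\<lambda>x. \<zero>\<^bsub>F\<^esub>"] linmap_const_zero[OF ses_simps(2)])
  next
    case (Suc j)
    then obtain w where w: "linmap R (P j) M w" "\<forall>x\<in>carrier (P i). \<psi> (y x) = w (d j x)"
      using assms by (auto simp: coboundary_Suc)
    then obtain w' where w': "linmap R (P j) F w'" "\<forall>x\<in>carrier (P j). \<psi> (w' x) = w x"
      using ses_lift by blast
    \<comment> \<open>The bounding map w lifts to F since \<open>P j\<close> is projective, and the
      lift followed back along d gives v.\<close>
    show ?thesis using Suc w w' linmap_comp_d[OF w'(1)]
      by (intro exI[of _ "\<lambda>x. w' (d j x)"]) (auto simp: coboundary_Suc d_closed)
  qed
  then obtain v where v: "coboundary F i v" "linmap R (P i) F v"
      "\<And>x. x \<in> carrier (P i) \<Longrightarrow> \<psi> (v x) = \<psi> (y x)" by blast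
  have yv: "linmap R (P i) F (\<lambda>x. y x \<ominus>\<^bsub>F\<^esub> v x)"
    by (intro linmap_diff module_P ses_simps y v)
  have "\<psi> (y x \<ominus>\<^bsub>F\<^esub> v x) = \<zero>\<^bsub>M\<^esub>" if "x \<in> carrier (P i)" for x
    using that v linmap_closed[OF y] linmap_closed[OF v(2)] linmap_closed[OF ses_simps(6)]
    by (simp add: linmap_minus[OF ses_simps(2,3,6)])
  from ses_factor[OF yv this] obtain w where w: "linmap R (P i) K w"
      "\<And>x. x \<in> carrier (P i) \<Longrightarrow> \<phi> (w x) = y x \<ominus>\<^bsub>F\<^esub> v x" by blast
  have "y x = v x \<oplus>\<^bsub>F\<^esub> \<phi> (w x)" if "x \<in> carrier (P i)" for x
  proof -
    have "y x \<in> carrier F" "v x \<in> carrier F"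
      by (rule linmap_closed[OF y that], rule linmap_closed[OF v(2) that])
    then show ?thesis using w(2)[OF that] by (simp add: F.M.minus_eq F.M.a_lcomm[of "v x" "y x"] F.M.r_neg)
  qed
  with v(1,2) w(1) show ?thesis by (intro exI[of _ v] exI[of _ w]) simp
qed

text \<open>Exactness of Ext^i(F) -> Ext^i(M) -> Ext^(i+1)(K) at the middle term.\<close>

lemma vanishes_quotient:
  assumes "vanishes F i" "vanishes K (Suc i)"
  shows "vanishes M i"
  unfolding vanishes_def
proof (intro allI impI)
  fix z assume z: "cocycle M i z"
  interpret K: module R K by (rule ses_simps)
  interpret F: module R F by (rule ses_simps)
  interpret M: module R M by (rule ses_simps)
  have zl: "linmap R (P i) M z" using z by (simp add: cocycle_def)
  from ses_lift[OF zl] obtain y where y: "linmap R (P i) F y" "\<forall>x\<in>carrier (P i). \<psi> (y x) = z x"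
    by blast
  have "\<psi> (y (d i x)) = \<zero>\<^bsub>M\<^esub>" if "x \<in> carrier (P (Suc i))" for x
    using y z that by (simp add: cocycle_def d_closed)
  \<comment> \<open>u represents the image of z under the connecting homomorphism: y lifts z, and y
    d takes values in the image of K.\<close>
  from ses_factor[OF linmap_comp_d[OF y(1)] this] obtain u where u: "linmap R (P (Suc i)) K u"
      "\<And>x. x \<in> carrier (P (Suc i)) \<Longrightarrow> \<phi> (u x) = y (d i x)" by blast
  have "cocycle K (Suc i) u"
    unfolding cocycle_def
  proof (intro conjI ballI u(1) inj_onD[OF ses_simps(5)])
    fix x assume x: "x \<in> carrier (P (Suc (Suc i)))"
    show "\<phi> (u (d (Suc i) x)) = \<phi> \<zero>\<^bsub>K\<^esub>"
      using x by (simp add: u(2) d_closed d_d linmap_zero[OF module_P _ y(1)] ses_simps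
          linmap_zero[OF ses_simps(1,2,4)])
    show "u (d (Suc i) x) \<in> carrier K" by (rule linmap_closed[OF u(1) d_closed[OF x]])
  qed simp
  with assms(2) obtain w where w: "linmap R (P i) K w"
      "\<forall>x\<in>carrier (P (Suc i)). u x = w (d i x)"
    by (auto simp: vanishes_def coboundary_Suc)
  have \<phi>w: "linmap R (P i) F (\<lambda>x. \<phi> (w x))" by (rule linmap_comp[OF w(1) ses_simps(4)])
  \<comment> \<open>The map w with u = w d measures the failure of y to be a cocycle; subtracting
    \<phi> w repairs it and keeps the image in M.\<close>
  have "cocycle F i (\<lambda>x. y x \<ominus>\<^bsub>F\<^esub> \<phi> (w x))"
    unfolding cocycle_def
  proof (intro conjI ballI linmap_diff module_P ses_simps y \<phi>w)
    fix x assume x: "x \<in> carrier (P (Suc i))"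
    then show "y (d i x) \<ominus>\<^bsub>F\<^esub> \<phi> (w (d i x)) = \<zero>\<^bsub>F\<^esub>"
      using w(2) u(2)[OF x] linmap_closed[OF y(1) d_closed[OF x]] by auto
  qed
  with assms(1) have "coboundary F i (\<lambda>x. y x \<ominus>\<^bsub>F\<^esub> \<phi> (w x))" by (simp add: vanishes_def)
  then have "coboundary M i (\<lambda>x. \<psi> (y x \<ominus>\<^bsub>F\<^esub> \<phi> (w x)))"
    by (rule coboundary_comp[OF ses_simps(2,3,6)])
  then show "coboundary M i z"
  proof (rule coboundary_cong)
    fix x assume x: "x \<in> carrier (P i)"
    have "y x \<in> carrier F" "\<phi> (w x) \<in> carrier F" "w x \<in> carrier K" "z x \<in> carrier M"
      by (rule linmap_closed[OF y(1) x], rule linmap_closed[OF \<phi>w x],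
        rule linmap_closed[OF w(1) x], rule linmap_closed[OF zl x])
    then show "\<psi> (y x \<ominus>\<^bsub>F\<^esub> \<phi> (w x)) = z x"
      using x y(2) by (simp add: linmap_minus[OF ses_simps(2,3,6)] ses_comp_zero)
  qed
qed

text \<open>Exactness of Ext^i(M) -> Ext^(i+1)(K) -> Ext^(i+1)(F) at the middle term. The second map
  is assumed zero rather than its target, which is what the case of a free K calls for.\<close>

lemma vanishes_kernel:
  assumes "vanishes M i" and "\<And>z. cocycle K (Suc i) z \<Longrightarrow> coboundary F (Suc i) (\<lambda>x. \<phi> (z x))"
  shows "vanishes K (Suc i)"
  unfolding vanishes_def
proof (intro allI impI)
  fix z assume z: "cocycle K (Suc i) z"
  interpret F: module R F by (rule ses_simps)
  have zl: "linmap R (P (Suc i)) K z" using z by (simp add: cocycle_def)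
  from assms(2)[OF z] obtain y where y: "linmap R (P i) F y"
      "\<And>x. x \<in> carrier (P (Suc i)) \<Longrightarrow> \<phi> (z x) = y (d i x)"
    by (auto simp: coboundary_Suc)
  \<comment> \<open>The connecting homomorphism sends the class of \<psi> y to that of z.\<close>
  have "cocycle M i (\<lambda>x. \<psi> (y x))"
    unfolding cocycle_def
    using linmap_comp[OF y(1) ses_simps(6)] linmap_closed[OF zl]
    by (auto simp: y(2)[symmetric] ses_comp_zero)
  with assms(1) have "coboundary M i (\<lambda>x. \<psi> (y x))" by (simp add: vanishes_def)
  from coboundary_lift[OF y(1) this] obtain v w where v: "linmap R (P i) K w" "coboundary F i v"
      "linmap R (P i) F v" "\<And>x. x \<in> carrier (P i) \<Longrightarrow> y x = v x \<oplus>\<^bsub>F\<^esub> \<phi> (w x)" by blast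
  \<comment> \<open>v is a boundary, so v d = 0 and \<phi> z = y d = \<phi> w d; injectivity of
    \<phi> then gives z = w d.\<close>
  have v0: "v (d i x) = \<zero>\<^bsub>F\<^esub>" if x: "x \<in> carrier (P (Suc i))" for x
  proof (cases i)
    case 0
    then show ?thesis using v(2) d_closed[OF x] by (simp add: coboundary_0)
  next
    case (Suc j)
    then obtain t where t: "linmap R (P j) F t" "\<forall>x\<in>carrier (P i). v x = t (d j x)"
      using v(2) by (auto simp: coboundary_Suc)
    then show ?thesis using Suc d_closed[OF x] x d_d
      by (simp add: linmap_zero[OF module_P ses_simps(2) t(1)])
  qed
  have "z x = w (d i x)" if x: "x \<in> carrier (P (Suc i))" for x
  proof (rule inj_onD[OF ses_simps(5)])
    have "\<phi> (w (d i x)) \<in> carrier F"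
      using linmap_closed[OF ses_simps(4)] linmap_closed[OF v(1)] d_closed[OF x] by blast
    then show "\<phi> (z x) = \<phi> (w (d i x))" using x by (simp add: y(2) v(4) d_closed v0)
    show "z x \<in> carrier K" "w (d i x) \<in> carrier K"
      using linmap_closed[OF zl] linmap_closed[OF v(1)] d_closed[OF x] x by blast+
  qed
  with v(1) show "coboundary K (Suc i) z" by (auto simp: coboundary_Suc)
qed

text \<open>No connecting map ends in degree 0: what bounds in F there is zero, and \<phi> is
  injective.\<close>

lemma vanishes_kernel_0:
  assumes "\<And>z. cocycle K 0 z \<Longrightarrow> coboundary F 0 (\<lambda>x. \<phi> (z x))"
  shows "vanishes K 0"
  unfolding vanishes_def
proof (intro allI impI)
  fix z assume z: "cocycle K 0 z"
  interpret K: module R K by (rule ses_simps)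
  show "coboundary K 0 z" unfolding coboundary_0
  proof
    fix x assume x: "x \<in> carrier (P 0)"
    show "z x = \<zero>\<^bsub>K\<^esub>"
      using assms[OF z] x z linmap_zero[OF ses_simps(1,2,4)]
      by (intro inj_onD[OF ses_simps(5)]) (auto simp: coboundary_0 cocycle_def linmap_closed)
  qed
qed

end

end

section \<open>Minimal free resolutions over a Noetherian local ring\<close>

text \<open>An inductive closure turns inclusions between spans into inductions on membership
  instead of computations with finite sums; \<open>fin_gen_mspan\<close> and
  \<open>mspan_image_eq\<close> connect it with linear combinations.\<close>

inductive_set mspan ::
  "('r, 'a) ring_scheme \<Rightarrow> ('r, 'm, 'b) module_scheme \<Rightarrow> 'm set \<Rightarrow> 'm set"
  for R :: "('r, 'a) ring_scheme" and M :: "('r, 'm, 'b) module_scheme" and G :: "'m set"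
  where
    zero: "\<zero>\<^bsub>M\<^esub> \<in> mspan R M G"
  | gen: "g \<in> G \<Longrightarrow> g \<in> mspan R M G"
  | add: "x \<in> mspan R M G \<Longrightarrow> y \<in> mspan R M G \<Longrightarrow> x \<oplus>\<^bsub>M\<^esub> y \<in> mspan R M G"
  | smult: "a \<in> carrier R \<Longrightarrow> x \<in> mspan R M G \<Longrightarrow> a \<odot>\<^bsub>M\<^esub> x \<in> mspan R M G"

lemma mspan_leastI:
  assumes "G \<subseteq> K" "\<zero>\<^bsub>M\<^esub> \<in> K" "\<And>x y. x \<in> K \<Longrightarrow> y \<in> K \<Longrightarrow> x \<oplus>\<^bsub>M\<^esub> y \<in> K"
    and "\<And>a x. a \<in> carrier R \<Longrightarrow> x \<in> K \<Longrightarrow> a \<odot>\<^bsub>M\<^esub> x \<in> K"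
  shows "mspan R M G \<subseteq> K"
proof
  fix x assume "x \<in> mspan R M G"
  then show "x \<in> K" by induction (use assms in auto)
qed

lemma mspan_subsetI: "G \<subseteq> mspan R M H \<Longrightarrow> mspan R M G \<subseteq> mspan R M H"
  by (rule mspan_leastI) (auto intro: mspan.intros)

lemma mspan_mono: "G \<subseteq> H \<Longrightarrow> mspan R M G \<subseteq> mspan R M H"
  by (rule mspan_subsetI) (auto intro: mspan.gen)

lemma mspan_closed:
  assumes "module R M" "G \<subseteq> carrier M"
  shows "mspan R M G \<subseteq> carrier M"
proof -
  interpret M: module R M by fact
  show ?thesis by (rule mspan_leastI) (use assms(2) in auto)
qed

lemma fin_gen_mspan:
  assumes "fin_gen_module R M"
  shows "\<exists>G. finite G \<and> G \<subseteq> carrier M \<and> mspan R M G = carrier M"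
proof -
  obtain G where M: "module R M" and G: "finite G" "G \<subseteq> carrier M"
    and gen: "\<forall>x\<in>carrier M. \<exists>c\<in>G \<rightarrow> carrier R. x = (\<Oplus>\<^bsub>M\<^esub>s\<in>G. c s \<odot>\<^bsub>M\<^esub> s)"
    using assms unfolding fin_gen_module_def by blast
  interpret M: module R M by fact
  have sum: "(\<Oplus>\<^bsub>M\<^esub>s\<in>T. c s \<odot>\<^bsub>M\<^esub> s) \<in> mspan R M G"
    if "finite T" "T \<subseteq> G" "c \<in> G \<rightarrow> carrier R" for T c
    using that
  proof (induction T rule: finite_induct)
    case empty
    show ?case by (simp add: mspan.zero)
  next
    case (insert s T)
    then have "(\<Oplus>\<^bsub>M\<^esub>s\<in>insert s T. c s \<odot>\<^bsub>M\<^esub> s) = c s \<odot>\<^bsub>M\<^esub> s \<oplus>\<^bsub>M\<^esub> (\<Oplus>\<^bsub>M\<^esub>s\<in>T. c s \<odot>\<^bsub>M\<^esub> s)"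
      using G by (intro M.M.finsum_insert) (auto simp: Pi_iff subset_iff)
    also have "\<dots> \<in> mspan R M G"
      using insert by (intro mspan.add mspan.smult) (auto intro: mspan.gen)
    finally show ?case .
  qed
  have "carrier M \<subseteq> mspan R M G"
  proof
    fix x assume "x \<in> carrier M"
    from bspec[OF gen this] obtain c where "c \<in> G \<rightarrow> carrier R" "x = (\<Oplus>\<^bsub>M\<^esub>s\<in>G. c s \<odot>\<^bsub>M\<^esub> s)"
      by (rule bexE)
    then show "x \<in> mspan R M G" using sum[OF G(1) subset_refl] by simp
  qed
  then have "mspan R M G = carrier M" by (rule subset_antisym[OF mspan_closed[OF M G(2)]])
  with G show ?thesis by (intro exI[of _ G]) simp
qed

context cring
begin

lemma mspan_image_eq:
  assumes M: "module R M" and v: "v \<in> S \<rightarrow> carrier M"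
  shows "mspan R M (v ` S) = lincomb R M v ` carrier (fmod R S)"
proof
  interpret M: module R M by fact
  interpret F: module R "fmod R S" by (rule module_fmod)
  note lin = linmap_lincomb[OF M v]
  show "mspan R M (v ` S) \<subseteq> lincomb R M v ` carrier (fmod R S)"
  proof (rule mspan_leastI)
    show "v ` S \<subseteq> lincomb R M v ` carrier (fmod R S)"
    proof safe
      fix s assume "s \<in> S"
      then show "v s \<in> lincomb R M v ` carrier (fmod R S)"
        using imageI[OF unit_vec_closed, of s S "lincomb R M v"] by (simp add: lincomb_unit_vec[OF M v])
    qed
    show "\<zero>\<^bsub>M\<^esub> \<in> lincomb R M v ` carrier (fmod R S)"
      using imageI[OF F.M.zero_closed, of "lincomb R M v"]
      by (simp add: linmap_zero[OF F.module_axioms M lin])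
    fix x y assume "x \<in> lincomb R M v ` carrier (fmod R S)" "y \<in> lincomb R M v ` carrier (fmod R S)"
    then show "x \<oplus>\<^bsub>M\<^esub> y \<in> lincomb R M v ` carrier (fmod R S)"
      by (auto simp: linmap_add[OF lin, symmetric])
  next
    fix a x assume "a \<in> carrier R" "x \<in> lincomb R M v ` carrier (fmod R S)"
    then show "a \<odot>\<^bsub>M\<^esub> x \<in> lincomb R M v ` carrier (fmod R S)"
      by (auto simp: linmap_smult[OF lin, symmetric])
  qed
  show "lincomb R M v ` carrier (fmod R S) \<subseteq> mspan R M (v ` S)"
  proof safe
    fix f assume "f \<in> carrier (fmod R S)"
    then show "lincomb R M v f \<in> mspan R M (v ` S)" using fmodD(1)[OF \<open>f \<in> _\<close>]
    proof (induction f rule: fmod_induct)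
      case zero
      show ?case using linmap_zero[OF F.module_axioms M lin] by (simp add: fmod_simps mspan.zero)
    next
      case (step g s a)
      then show ?case
        by (simp add: linmap_add[OF lin] linmap_smult[OF lin] unit_vec_closed
          lincomb_unit_vec[OF M v] mspan.add mspan.smult mspan.gen)
    qed
  qed
qed

lemma idealI_closed:
  assumes "I \<subseteq> carrier R" "\<zero> \<in> I" "\<And>x y. x \<in> I \<Longrightarrow> y \<in> I \<Longrightarrow> x \<oplus> y \<in> I"
    and "\<And>a x. a \<in> carrier R \<Longrightarrow> x \<in> I \<Longrightarrow> a \<otimes> x \<in> I"
  shows "ideal I R"
proof (rule idealI[OF ring_axioms])
  show "subgroup I (add_monoid R)"
  proof (rule subgroup.intro)
    fix x assume x: "x \<in> I"
    then have "\<ominus> x = (\<ominus> \<one>) \<otimes> x" using assms(1) by (auto simp: l_minus)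
    then show "inv\<^bsub>add_monoid R\<^esub> x \<in> I" using assms(4)[of "\<ominus> \<one>" x] x by (simp add: a_inv_def)
  qed (use assms in auto)
  fix a x assume "a \<in> I" "x \<in> carrier R"
  moreover from this have "a \<otimes> x = x \<otimes> a" using assms(1) by (intro m_comm) auto
  ultimately show "x \<otimes> a \<in> I" "a \<otimes> x \<in> I" using assms by simp_all
qed

end

section \<open>Noetherian local rings: units, minimal covers, finitely generated syzygies\<close>

locale noetherian_local_ring = cring R + noetherian_ring R for R (structure) +
  fixes \<mm>
  assumes local: "local_ring R \<mm>"
begin

lemma maximal: "maximalideal \<mm> R"
  using local by (simp add: local_ring_def)

sublocale \<mm>: maximalideal \<mm> R by (rule maximal)

lemma one_notin_max: "\<one> \<notin> \<mm>"
  using \<mm>.one_imp_carrier \<mm>.I_notcarr by blast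

text \<open>A non-unit lies in some maximal ideal, and \<mm> is the only one. The maximal ideal is
  found by Zorn's lemma among the ideals that contain \<open>r\<close> but not \<one>.\<close>

lemma unit_of_notin_max:
  assumes r: "r \<in> carrier R" "r \<notin> \<mm>"
  shows "\<exists>c\<in>carrier R. c \<otimes> r = \<one>"
proof (rule ccontr)
  assume no: "\<not> ?thesis"
  define C where "C = {I. ideal I R \<and> r \<in> I \<and> \<one> \<notin> I}"
  have "PIdl r \<in> C"
    using no cgenideal_ideal[OF r(1)] cgenideal_self[OF r(1)] by (auto simp: C_def cgenideal_def)
  have "\<exists>J\<in>C. \<forall>I\<in>C. J \<subseteq> I \<longrightarrow> I = J"
  proof (rule subset_Zorn)
    fix D assume D: "subset.chain C D"
    show "\<exists>U\<in>C. \<forall>I\<in>D. I \<subseteq> U"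
    proof (cases "D = {}")
      case True
      with \<open>PIdl r \<in> C\<close> show ?thesis by blast
    next
      case False
      have "subset.chain {I. ideal I R} D" using D by (auto simp: subset_chain_def C_def)
      \<comment> \<open>In a Noetherian ring a nonempty chain of ideals contains its own union, so
        the upper bound is a member of the chain.\<close>
      from ideal_chain_is_trivial[OF False this] show ?thesis
        using D by (auto simp: subset_chain_def)
    qed
  qed
  then obtain J where J: "J \<in> C" "\<forall>I\<in>C. J \<subseteq> I \<longrightarrow> I = J" by blast
  have "maximalideal J R"
  proof (rule maximalidealI)
    show "ideal J R" "carrier R \<noteq> J" using J(1) by (auto simp: C_def)
    fix I assume I: "ideal I R" "J \<subseteq> I" "I \<subseteq> carrier R"
    then show "I = J \<or> I = carrier R"
      using J ideal.one_imp_carrier[OF I(1)] by (auto simp: C_def)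
  qed
  then have "J = \<mm>" using local by (simp add: local_ring_def)
  with J(1) r(2) show False by (simp add: C_def)
qed

text \<open>
  A generating family of least cardinality works: a relation with a unit coefficient would make one
  of its members redundant.
\<close>

lemma minimal_cover:
  assumes inf: "infinite (UNIV :: 'x set)" and M: "module R M" and G: "finite G" "G \<subseteq> carrier M"
  shows "\<exists>(S :: 'x set) e. finite S \<and> linmap R (fmod R S) M e \<and>
    e ` carrier (fmod R S) = mspan R M G \<and>
    (\<forall>f\<in>carrier (fmod R S). e f = \<zero>\<^bsub>M\<^esub> \<longrightarrow> (\<forall>x. f x \<in> \<mm>))"
proof -
  interpret M: module R M by fact
  \<comment> \<open>Generators are families indexed by subsets of \<open>'x\<close>, so that
    \<open>S\<close> can serve directly as the basis set; the infinite type offers index sets of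
    every finite size.\<close>
  define Q where "Q n \<longleftrightarrow> (\<exists>(S :: 'x set) v. finite S \<and> card S = n \<and> v \<in> S \<rightarrow> carrier M \<and>
    mspan R M (v ` S) = mspan R M G)" for n
  obtain S0 :: "'x set" where "finite S0" "card S0 = card G"
    using infinite_arbitrarily_large[OF inf] by blast
  then obtain v0 where v0: "bij_betw v0 S0 G" using G(1) finite_same_card_bij by metis
  then have "v0 ` S0 = G" by (simp add: bij_betw_def)
  then have "Q (card G)"
    using \<open>finite S0\<close> \<open>card S0 = card G\<close> G(2) by (auto simp: Q_def intro!: exI[of _ S0] exI[of _ v0])
  then have "Q (LEAST n. Q n)" by (rule LeastI)
  then obtain S :: "'x set" and v where S: "finite S" "card S = (LEAST n. Q n)"
    and v: "v \<in> S \<rightarrow> carrier M" "mspan R M (v ` S) = mspan R M G" by (auto simp: Q_def)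
  interpret F: module R "fmod R S" by (rule module_fmod)
  note lin = linmap_lincomb[OF M v(1)]
  have "f x \<in> \<mm>" if f: "f \<in> carrier (fmod R S)" "lincomb R M v f = \<zero>\<^bsub>M\<^esub>" for f x
  proof (rule ccontr)
    assume x: "f x \<notin> \<mm>"
    then have xS: "x \<in> S" using fmodD(2)[OF f(1)] \<mm>.zero_closed by metis
    obtain c where c: "c \<in> carrier R" "c \<otimes> f x = \<one>"
      using unit_of_notin_max[OF fmodD(1)[OF f(1)] x] by blast
    \<comment> \<open>\<open>g\<close> has coordinate zero at \<open>x\<close> but the same image as
      the basis vector there, because c inverts \<open>f x\<close> and \<open>f\<close> maps to
      zero: \<open>v x\<close> lies in the span of the other generators.\<close>
    define g where "g = unit_vec R x \<ominus>\<^bsub>fmod R S\<^esub> c \<odot>\<^bsub>fmod R S\<^esub> f"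
    have cf: "c \<odot>\<^bsub>fmod R S\<^esub> f \<in> carrier (fmod R S)" "unit_vec R x \<in> carrier (fmod R S)"
      using c f xS by (auto simp: unit_vec_closed)
    have g: "g \<in> carrier (fmod R S)" using cf by (simp add: g_def)
    have "g x = \<zero>" using c unfolding g_def fmod_minus[OF cf(2,1)]
      by (simp add: fmod_simps unit_vec_def minus_eq r_neg)
    with g have g': "g \<in> carrier (fmod R (S - {x}))"
      by (auto simp: fmod_def)
    have "lincomb R M v g = v x"
      using cf f c xS funcset_mem[OF v(1) xS] unfolding g_def
      by (simp add: linmap_minus[OF F.module_axioms M lin] linmap_smult[OF lin]
        lincomb_unit_vec[OF M v(1)])
    then have "v x \<in> lincomb R M v ` carrier (fmod R (S - {x}))"
      using imageI[OF g', of "lincomb R M v"] by simp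
    also have "\<dots> = mspan R M (v ` (S - {x}))"
      using v(1) by (intro mspan_image_eq[OF M, symmetric]) auto
    finally have "v ` S \<subseteq> mspan R M (v ` (S - {x}))" by (auto intro: mspan.gen)
    then have "mspan R M (v ` S) \<subseteq> mspan R M (v ` (S - {x}))" by (rule mspan_subsetI)
    moreover have "mspan R M (v ` (S - {x})) \<subseteq> mspan R M (v ` S)" by (intro mspan_mono) auto
    ultimately have "Q (card (S - {x}))"
      using S v by (auto simp: Q_def intro!: exI[of _ "S - {x}"] exI[of _ v])
    moreover have "card (S - {x}) < (LEAST n. Q n)"
      using card_Diff1_less[OF S(1) xS] S(2) by simp
    ultimately show False using not_less_Least by blast
  qed
  then show ?thesis using S(1) lin v(2) mspan_image_eq[OF M v(1)]
    by (intro exI[of _ S] exI[of _ "lincomb R M v"]) simp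
qed

text \<open>
  The supports range over \<open>S\<close> while the ambient module \<open>fmod R T\<close> stays fixed, so that the induction
  on \<open>S\<close> does not change the module.
\<close>

lemma fmod_noetherian:
  assumes "finite S" "K \<subseteq> carrier (fmod R T)" "\<And>f x. f \<in> K \<Longrightarrow> x \<notin> S \<Longrightarrow> f x = \<zero>"
    and "\<zero>\<^bsub>fmod R T\<^esub> \<in> K" "\<And>f g. f \<in> K \<Longrightarrow> g \<in> K \<Longrightarrow> f \<oplus>\<^bsub>fmod R T\<^esub> g \<in> K"
    and "\<And>a f. a \<in> carrier R \<Longrightarrow> f \<in> K \<Longrightarrow> a \<odot>\<^bsub>fmod R T\<^esub> f \<in> K"
  shows "\<exists>G. finite G \<and> G \<subseteq> K \<and> mspan R (fmod R T) G = K"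
  using assms
proof (induction S arbitrary: K rule: finite_induct)
  case empty
  then have "K = {\<zero>\<^bsub>fmod R T\<^esub>}" by (auto simp: fmod_simps fun_eq_iff)
  moreover have "mspan R (fmod R T) {} \<subseteq> K" by (rule mspan_leastI) (use empty.prems in auto)
  ultimately show ?case by (intro exI[of _ "{}"]) (auto intro: mspan.zero)
next
  case (insert s S)
  note K = insert.prems
  interpret F: module R "fmod R T" by (rule module_fmod)
  have Kc: "f x \<in> carrier R" if "f \<in> K" for f x by (rule fmodD(1)[OF subsetD[OF K(1) that]])
  \<comment> \<open>The \<open>s\<close>-coordinates of \<open>K\<close> form an ideal, hence a
    finitely generated one; \<open>l\<close> will choose elements of \<open>K\<close> with the
    generators as \<open>s\<close>-coordinates.\<close>
  have "ideal ((\<lambda>f. f s) ` K) R"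
  proof (rule idealI_closed)
    show "(\<lambda>f. f s) ` K \<subseteq> carrier R" using Kc by auto
    show "\<zero> \<in> (\<lambda>f. f s) ` K" using K(3) by (auto simp: fmod_simps image_iff)
    show "x \<oplus> y \<in> (\<lambda>f. f s) ` K" if "x \<in> (\<lambda>f. f s) ` K" "y \<in> (\<lambda>f. f s) ` K" for x y
      using that K(4) by (auto simp: fmod_simps image_iff)
    show "a \<otimes> x \<in> (\<lambda>f. f s) ` K" if "a \<in> carrier R" "x \<in> (\<lambda>f. f s) ` K" for a x
      using that K(5) by (auto simp: fmod_simps image_iff)
  qed
  from finetely_gen[OF this] obtain A where A: "A \<subseteq> carrier R" "finite A" "(\<lambda>f. f s) ` K = Idl A"
    by blast
  have "\<forall>a\<in>A. \<exists>f\<in>K. f s = a"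
  proof
    fix a assume "a \<in> A"
    then have "a \<in> (\<lambda>f. f s) ` K" using genideal_self[OF A(1)] A(3) by blast
    then show "\<exists>f\<in>K. f s = a" by (auto simp: image_iff)
  qed
  then obtain l where l: "\<forall>a\<in>A. l a \<in> K \<and> l a s = a" by metis
  have lK: "mspan R (fmod R T) (l ` A) \<subseteq> K"
  proof (rule mspan_leastI)
    show "l ` A \<subseteq> K" using l by blast
  qed (simp_all add: K(3-5))
  have "ideal ((\<lambda>f. f s) ` mspan R (fmod R T) (l ` A)) R"
  proof (rule idealI_closed)
    let ?J = "(\<lambda>f. f s) ` mspan R (fmod R T) (l ` A)"
    show "?J \<subseteq> carrier R" using lK Kc by auto
    show "\<zero> \<in> ?J" using mspan.zero[of "fmod R T" R "l ` A"] by (force simp: fmod_simps)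
    show "x \<oplus> y \<in> ?J" if xy: "x \<in> ?J" "y \<in> ?J" for x y
    proof -
      obtain f g where "f \<in> mspan R (fmod R T) (l ` A)" "g \<in> mspan R (fmod R T) (l ` A)"
        "x = f s" "y = g s" using xy by blast
      then show ?thesis using mspan.add[of f R "fmod R T" "l ` A" g]
        by (intro image_eqI[of _ _ "f \<oplus>\<^bsub>fmod R T\<^esub> g"]) (auto simp: fmod_simps)
    qed
    show "a \<otimes> x \<in> ?J" if ax: "a \<in> carrier R" "x \<in> ?J" for a x
    proof -
      obtain f where "f \<in> mspan R (fmod R T) (l ` A)" "x = f s" using ax by blast
      then show ?thesis using mspan.smult[OF ax(1), of f "fmod R T" "l ` A"]
        by (intro image_eqI[of _ _ "a \<odot>\<^bsub>fmod R T\<^esub> f"]) (auto simp: fmod_simps)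
    qed
  qed
  moreover have "A \<subseteq> (\<lambda>f. f s) ` mspan R (fmod R T) (l ` A)"
  proof
    fix a assume "a \<in> A"
    then show "a \<in> (\<lambda>f. f s) ` mspan R (fmod R T) (l ` A)"
      using l by (intro image_eqI[of _ _ "l a"]) (auto intro: mspan.gen)
  qed
  ultimately have J: "(\<lambda>f. f s) ` K \<subseteq> (\<lambda>f. f s) ` mspan R (fmod R T) (l ` A)"
    unfolding A(3) by (rule genideal_minimal)
  \<comment> \<open>Elements with \<open>s\<close>-coordinate zero are supported in \<open>S\<close>
    and fall under the induction hypothesis; every \<open>f\<close> in \<open>K\<close> differs from
    such an element by one in the span of the chosen lifts.\<close>
  have "\<exists>G. finite G \<and> G \<subseteq> {f \<in> K. f s = \<zero>} \<and> mspan R (fmod R T) G = {f \<in> K. f s = \<zero>}"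
  proof (rule insert.IH)
    show "f x = \<zero>" if "f \<in> {f \<in> K. f s = \<zero>}" "x \<notin> S" for f x
      using that K(2)[of f x] by (cases "x = s") auto
  qed (use K(1) in \<open>auto simp: K(3-5)[unfolded fmod_simps] fmod_simps\<close>)
  then obtain G where G: "finite G" "G \<subseteq> K" "mspan R (fmod R T) G = {f \<in> K. f s = \<zero>}" by blast
  have "mspan R (fmod R T) (l ` A \<union> G) \<subseteq> K"
  proof (rule mspan_leastI)
    show "l ` A \<union> G \<subseteq> K" using l G(2) by blast
  qed (simp_all add: K(3-5))
  moreover have "K \<subseteq> mspan R (fmod R T) (l ` A \<union> G)"
  proof
    fix f assume f: "f \<in> K"
    then obtain g where g: "g \<in> mspan R (fmod R T) (l ` A)" "f s = g s" using J by blast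
    have gK: "g \<in> K" using g lK by blast
    define h where "h = f \<oplus>\<^bsub>fmod R T\<^esub> (\<ominus> \<one>) \<odot>\<^bsub>fmod R T\<^esub> g"
    have "h \<in> K" using f gK by (simp add: h_def K(4,5))
    moreover have "h s = \<zero>" using g(2) Kc[OF gK] by (simp add: h_def fmod_simps l_minus r_neg)
    ultimately have "h \<in> mspan R (fmod R T) G" using G(3) by blast
    then have "h \<oplus>\<^bsub>fmod R T\<^esub> g \<in> mspan R (fmod R T) (l ` A \<union> G)"
      using g(1) by (intro mspan.add) (auto intro: subsetD[OF mspan_mono, rotated])
    also have "h \<oplus>\<^bsub>fmod R T\<^esub> g = f"
      using Kc[OF f] Kc[OF gK] by (auto simp: h_def fmod_simps fun_eq_iff a_assoc l_minus l_neg)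
    finally show "f \<in> mspan R (fmod R T) (l ` A \<union> G)" .
  qed
  ultimately have "mspan R (fmod R T) (l ` A \<union> G) = K" by (rule subset_antisym)
  moreover have "l ` A \<union> G \<subseteq> K" using l G(2) by blast
  ultimately show ?case using G(1) A(2) by (intro exI[of _ "l ` A \<union> G"]) simp
qed

text \<open>The last clause is minimality. Resolutions are infinite sequences; the length is encoded
  in \<open>S\<close>, since by \<open>min_resolution_empty_Suc\<close> an empty set is followed by
  empty ones.\<close>

definition min_resolution ::
  "('a, 'm, 'c) module_scheme \<Rightarrow> (nat \<Rightarrow> 'x set) \<Rightarrow> (nat \<Rightarrow> ('x \<Rightarrow> 'a) \<Rightarrow> 'x \<Rightarrow> 'a)
    \<Rightarrow> (('x \<Rightarrow> 'a) \<Rightarrow> 'm) \<Rightarrow> bool"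
  where "min_resolution M S d e \<longleftrightarrow> (\<forall>i. finite (S i)) \<and>
    linmap R (fmod R (S 0)) M e \<and> e ` carrier (fmod R (S 0)) = carrier M \<and>
    (\<forall>i. linmap R (fmod R (S (Suc i))) (fmod R (S i)) (d i)) \<and>
    d 0 ` carrier (fmod R (S 1)) = {f \<in> carrier (fmod R (S 0)). e f = \<zero>\<^bsub>M\<^esub>} \<and>
    (\<forall>i. d (Suc i) ` carrier (fmod R (S (Suc (Suc i))))
      = {f \<in> carrier (fmod R (S (Suc i))). d i f = (\<lambda>x. \<zero>)}) \<and>
    (\<forall>i. \<forall>f\<in>carrier (fmod R (S (Suc i))). \<forall>x. d i f x \<in> \<mm>)"

lemma min_resolution_exists:
  assumes inf: "infinite (UNIV :: 'x set)" and fg: "fin_gen_module R M"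
  shows "\<exists>(S :: nat \<Rightarrow> 'x set) d e. min_resolution M S d e"
proof -
  have M: "module R M" using fg by (simp add: fin_gen_module_def)
  interpret M: module R M by fact
  obtain G where G: "finite G" "G \<subseteq> carrier M" "mspan R M G = carrier M"
    using fin_gen_mspan[OF fg] by blast
  obtain S0 :: "'x set" and e where S0: "finite S0" "linmap R (fmod R S0) M e"
      "e ` carrier (fmod R S0) = carrier M"
      "\<forall>f\<in>carrier (fmod R S0). e f = \<zero>\<^bsub>M\<^esub> \<longrightarrow> (\<forall>x. f x \<in> \<mm>)"
    using minimal_cover[OF inf M G(1,2)] unfolding G(3) by blast
  \<comment> \<open>A state \<open>(S, K)\<close> holds a basis set and the submodule of
    \<open>fmod R S\<close> that the next differential has to cover, the kernel of the previous map.
    Closure of \<open>K\<close> belongs to the state because \<open>fmod_noetherian\<close> asks for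
    it.\<close>
  define I :: "nat \<Rightarrow> 'x set \<times> ('x \<Rightarrow> 'a) set \<Rightarrow> bool" where
    "I n = (\<lambda>(S, K). finite S \<and> K \<subseteq> carrier (fmod R S) \<and> (\<forall>f\<in>K. \<forall>x. f x \<in> \<mm>) \<and>
      \<zero>\<^bsub>fmod R S\<^esub> \<in> K \<and> (\<forall>f\<in>K. \<forall>g\<in>K. f \<oplus>\<^bsub>fmod R S\<^esub> g \<in> K) \<and>
      (\<forall>a\<in>carrier R. \<forall>f\<in>K. a \<odot>\<^bsub>fmod R S\<^esub> f \<in> K) \<and>
      (n = 0 \<longrightarrow> S = S0 \<and> K = {f \<in> carrier (fmod R S0). e f = \<zero>\<^bsub>M\<^esub>}))" for n
  define J :: "'x set \<times> ('x \<Rightarrow> 'a) set \<Rightarrow> 'x set \<times> ('x \<Rightarrow> 'a) set \<Rightarrow> (('x \<Rightarrow> 'a) \<Rightarrow> 'x \<Rightarrow> 'a) \<Rightarrow> bool"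
    where "J p q d \<longleftrightarrow> linmap R (fmod R (fst q)) (fmod R (fst p)) d \<and>
      d ` carrier (fmod R (fst q)) = snd p \<and>
      snd q = {f \<in> carrier (fmod R (fst q)). d f = \<zero>\<^bsub>fmod R (fst p)\<^esub>}" for p q d
  have ker: "\<zero>\<^bsub>fmod R S\<^esub> \<in> {f \<in> carrier (fmod R S). d f = \<zero>\<^bsub>L\<^esub>}"
      "\<forall>f\<in>{f \<in> carrier (fmod R S). d f = \<zero>\<^bsub>L\<^esub>}. \<forall>g\<in>{f \<in> carrier (fmod R S). d f = \<zero>\<^bsub>L\<^esub>}.
        f \<oplus>\<^bsub>fmod R S\<^esub> g \<in> {f \<in> carrier (fmod R S). d f = \<zero>\<^bsub>L\<^esub>}"
      "\<forall>a\<in>carrier R. \<forall>f\<in>{f \<in> carrier (fmod R S). d f = \<zero>\<^bsub>L\<^esub>}.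
        a \<odot>\<^bsub>fmod R S\<^esub> f \<in> {f \<in> carrier (fmod R S). d f = \<zero>\<^bsub>L\<^esub>}"
    if d: "linmap R (fmod R S) L d" and L: "module R L" for S :: "'x set" and L :: "('a, 'l, 'z) module_scheme" and d
  proof -
    interpret F: module R "fmod R S" by (rule module_fmod)
    interpret L: module R L by fact
    show "\<zero>\<^bsub>fmod R S\<^esub> \<in> {f \<in> carrier (fmod R S). d f = \<zero>\<^bsub>L\<^esub>}"
      using linmap_zero[OF F.module_axioms L d] by simp
  qed (auto simp: linmap_add[OF d] linmap_smult[OF d] module.smult_closed[OF module_fmod]
    module.axioms(2)[OF module_fmod, THEN abelian_group.axioms(1), THEN abelian_monoid.a_closed]
    module.axioms(2)[OF L, THEN abelian_group.axioms(1), THEN abelian_monoid.l_zero]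
    module.axioms(2)[OF L, THEN abelian_group.axioms(1), THEN abelian_monoid.zero_closed]
    module.smult_r_null[OF L])
  have "\<exists>p. \<forall>n. I n (p n) \<and> (\<exists>d. J (p n) (p (Suc n)) d)"
  proof (rule dependent_nat_choice)
    show "\<exists>p. I 0 p"
      using S0 ker[OF S0(2) M] by (intro exI[of _ "(S0, {f \<in> carrier (fmod R S0). e f = \<zero>\<^bsub>M\<^esub>})"])
        (auto simp: I_def)
  next
    fix p n assume p: "I n p"
    obtain S K where pK: "p = (S, K)" by (cases p)
    have K: "finite S" "K \<subseteq> carrier (fmod R S)" "\<zero>\<^bsub>fmod R S\<^esub> \<in> K"
      "\<And>f g. f \<in> K \<Longrightarrow> g \<in> K \<Longrightarrow> f \<oplus>\<^bsub>fmod R S\<^esub> g \<in> K"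
      "\<And>a f. a \<in> carrier R \<Longrightarrow> f \<in> K \<Longrightarrow> a \<odot>\<^bsub>fmod R S\<^esub> f \<in> K"
      using p by (auto simp: I_def pK)
    have "\<exists>G. finite G \<and> G \<subseteq> K \<and> mspan R (fmod R S) G = K"
    proof (rule fmod_noetherian[OF K(1,2)])
      show "f x = \<zero>" if "f \<in> K" "x \<notin> S" for f x
        by (rule fmodD(2)[OF subsetD[OF K(2) that(1)] that(2)])
    qed (simp_all add: K(3-5))
    then obtain G where G: "finite G" "G \<subseteq> K" "mspan R (fmod R S) G = K" by blast
    obtain S' :: "'x set" and d where S': "finite S'" "linmap R (fmod R S') (fmod R S) d"
      "d ` carrier (fmod R S') = K"
      "\<forall>f\<in>carrier (fmod R S'). d f = \<zero>\<^bsub>fmod R S\<^esub> \<longrightarrow> (\<forall>x. f x \<in> \<mm>)"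
      using minimal_cover[OF inf module_fmod G(1) subset_trans[OF G(2) K(2)]] unfolding G(3) by blast
    let ?q = "(S', {f \<in> carrier (fmod R S'). d f = \<zero>\<^bsub>fmod R S\<^esub>})"
    have "I (Suc n) ?q" using S' ker[OF S'(2) module_fmod] by (auto simp: I_def)
    moreover have "J p ?q d" using S' by (simp add: J_def pK)
    ultimately show "\<exists>q. I (Suc n) q \<and> (\<exists>d. J p q d)" by blast
  qed
  then obtain p where p: "\<And>n. I n (p n)" "\<And>n. \<exists>d. J (p n) (p (Suc n)) d" by blast
  then obtain d where d: "\<And>n. J (p n) (p (Suc n)) (d n)" by metis
  have p0: "fst (p 0) = S0" "snd (p 0) = {f \<in> carrier (fmod R S0). e f = \<zero>\<^bsub>M\<^esub>}"
    using p(1)[of 0] by (auto simp: I_def split: prod.splits)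
  have fin: "finite (fst (p n))" "\<forall>f\<in>snd (p n). \<forall>x. f x \<in> \<mm>" for n
    using p(1)[of n] by (auto simp: I_def split: prod.splits)
  have "min_resolution M (\<lambda>n. fst (p n)) d e"
    unfolding min_resolution_def
  proof (intro conjI allI ballI)
    fix i
    show "finite (fst (p i))" by (rule fin)
    show "linmap R (fmod R (fst (p 0))) M e" "e ` carrier (fmod R (fst (p 0))) = carrier M"
      using S0 by (simp_all add: p0)
    show "linmap R (fmod R (fst (p (Suc i)))) (fmod R (fst (p i))) (d i)"
      using d[of i] by (simp add: J_def)
    show "d 0 ` carrier (fmod R (fst (p 1))) = {f \<in> carrier (fmod R (fst (p 0))). e f = \<zero>\<^bsub>M\<^esub>}"
      using d[of 0] by (simp add: J_def p0)
    show "d (Suc i) ` carrier (fmod R (fst (p (Suc (Suc i)))))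
        = {f \<in> carrier (fmod R (fst (p (Suc i)))). d i f = (\<lambda>x. \<zero>)}"
      using d[of i] d[of "Suc i"] by (simp add: J_def fmod_simps)
    fix f x assume "f \<in> carrier (fmod R (fst (p (Suc i))))"
    then have "d i f \<in> snd (p i)" using d[of i] by (auto simp: J_def)
    then show "d i f x \<in> \<mm>" using fin(2) by blast
  qed
  then show ?thesis by blast
qed

end

section \<open>Minimal resolutions compute the projective dimension\<close>

lemma projective_complexI:
  assumes "cring R" "projective_resolution R N P d \<epsilon>"
  shows "projective_complex R P d"
proof -
  interpret cring R by fact
  show ?thesis
  proof (unfold_locales)
    fix i x
    show "projective_module R (P i)" "linmap R (P (Suc i)) (P i) (d i)"
      using assms(2) by (auto simp: projective_resolution_def mod_hom_iff)
    assume "x \<in> carrier (P (Suc (Suc i)))"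
    then have "d (Suc i) x \<in> d (Suc i) ` carrier (P (Suc (Suc i)))" by (rule imageI)
    also have "\<dots> = a_kernel (P (Suc i)) (P i) (d i)"
      using assms(2) by (simp add: projective_resolution_def)
    finally show "d i (d (Suc i) x) = \<zero>\<^bsub>P i\<^esub>" by (simp add: a_kernel_def')
  qed
qed

lemma projective_resolutionD:
  assumes "projective_resolution R N P d \<epsilon>"
  shows "linmap R (P 0) N \<epsilon>" "\<epsilon> ` carrier (P 0) = carrier N"
    and "d 0 ` carrier (P 1) = {x \<in> carrier (P 0). \<epsilon> x = \<zero>\<^bsub>N\<^esub>}"
    and "d (Suc i) ` carrier (P (Suc (Suc i))) = {x \<in> carrier (P (Suc i)). d i x = \<zero>\<^bsub>P i\<^esub>}"
  using assms by (auto simp: projective_resolution_def mod_hom_iff a_kernel_def')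

context cring
begin

lemma carrier_fmod_empty: "carrier (fmod R {}) = {\<zero>\<^bsub>fmod R {}\<^esub>}"
  by (auto simp: fmod_def)

lemma module_self: "module R (self_module R)"
  by (rule moduleI[OF is_cring], rule abelian_groupI)
    (auto simp: self_module_def a_ac l_distr r_distr m_assoc intro: l_neg)

lemma self_simps: "carrier (self_module R) = carrier R" "\<zero>\<^bsub>self_module R\<^esub> = \<zero>"
  "x \<oplus>\<^bsub>self_module R\<^esub> y = x \<oplus> y" "x \<odot>\<^bsub>self_module R\<^esub> y = x \<otimes> y"
  by (simp_all add: self_module_def)

lemma linmap_coordinate: "linmap R (fmod R S) (self_module R) (\<lambda>f. f s)"
  by (auto simp: linmap_def self_simps fmod_simps fmodD)

end

context noetherian_local_ring
begin

text \<open>Linear maps carry \<mm> F into \<mm> G; this is how the term h d of a homotopy vanishes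
  modulo the maximal ideal.\<close>

lemma linmap_fmod_max:
  assumes h: "linmap R (fmod R S) (fmod R T) h" and f: "f \<in> carrier (fmod R S)" "\<And>x. f x \<in> \<mm>"
  shows "h f x \<in> \<mm>"
  using f
proof (induction f rule: fmod_induct)
  case zero
  have "h \<zero>\<^bsub>fmod R S\<^esub> = \<zero>\<^bsub>fmod R T\<^esub>" by (rule linmap_zero[OF module_fmod module_fmod h])
  then show ?case by (simp add: fmod_simps)
next
  case (step g s a)
  interpret F: module R "fmod R S" by (rule module_fmod)
  have s: "unit_vec R s \<in> carrier (fmod R S)" by (rule unit_vec_closed[OF \<open>s \<in> S\<close>])
  have "h (a \<odot>\<^bsub>fmod R S\<^esub> unit_vec R s \<oplus>\<^bsub>fmod R S\<^esub> g)
      = a \<odot>\<^bsub>fmod R T\<^esub> h (unit_vec R s) \<oplus>\<^bsub>fmod R T\<^esub> h g"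
    using step s by (simp add: linmap_add[OF h] linmap_smult[OF h])
  moreover have "a \<otimes> h (unit_vec R s) x \<in> \<mm>"
    using \<open>a \<in> \<mm>\<close> fmodD(1)[OF linmap_closed[OF h s]] by (rule \<mm>.I_r_closed)
  ultimately show ?case using step by (simp add: fmod_simps)
qed

context
  fixes M :: "('a, 'm, 'c) module_scheme" and S :: "nat \<Rightarrow> 'x set" and d e
  assumes M: "module R M" and res: "min_resolution M S d e"
begin

lemma min_resolutionD:
  shows "finite (S i)" "linmap R (fmod R (S 0)) M e" "e ` carrier (fmod R (S 0)) = carrier M"
    "linmap R (fmod R (S (Suc i))) (fmod R (S i)) (d i)"
    "d 0 ` carrier (fmod R (S (Suc 0))) = {f \<in> carrier (fmod R (S 0)). e f = \<zero>\<^bsub>M\<^esub>}"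
    "d (Suc i) ` carrier (fmod R (S (Suc (Suc i))))
      = {f \<in> carrier (fmod R (S (Suc i))). d i f = \<zero>\<^bsub>fmod R (S i)\<^esub>}"
    "f \<in> carrier (fmod R (S (Suc i))) \<Longrightarrow> d i f x \<in> \<mm>"
  using res by (simp_all add: min_resolution_def fmod_simps)

lemma min_resolution_complex: "projective_complex R (\<lambda>i. fmod R (S i)) d"
proof unfold_locales
  fix i x
  show "projective_module R (fmod R (S i))" by (rule projective_fmod)
  show "linmap R (fmod R (S (Suc i))) (fmod R (S i)) (d i)" by (rule min_resolutionD)
  assume "x \<in> carrier (fmod R (S (Suc (Suc i))))"
  then have "d (Suc i) x \<in> d (Suc i) ` carrier (fmod R (S (Suc (Suc i))))" by (rule imageI)
  then show "d i (d (Suc i) x) = \<zero>\<^bsub>fmod R (S i)\<^esub>" by (simp add: min_resolutionD(6))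
qed

text \<open>With nothing in degree j every element of degree j + 1 is a cycle, so a boundary, so has
  all coordinates in \<mm>; a basis vector has a coordinate \<one>.\<close>

lemma min_resolution_empty_Suc:
  assumes "S j = {}"
  shows "S (Suc j) = {}"
proof (rule ccontr)
  assume "S (Suc j) \<noteq> {}"
  then obtain s where s: "s \<in> S (Suc j)" by blast
  then have u: "unit_vec R s \<in> carrier (fmod R (S (Suc j)))" by (rule unit_vec_closed)
  then have "d j (unit_vec R s) = \<zero>\<^bsub>fmod R (S j)\<^esub>"
    using linmap_closed[OF min_resolutionD(4) u] by (simp add: assms carrier_fmod_empty)
  then have "unit_vec R s \<in> d (Suc j) ` carrier (fmod R (S (Suc (Suc j))))"
    using u by (simp add: min_resolutionD(6))
  then obtain f where "f \<in> carrier (fmod R (S (Suc (Suc j))))" "unit_vec R s = d (Suc j) f" by blast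
  then have "unit_vec R s s \<in> \<mm>" by (simp add: min_resolutionD(7))
  then show False using one_notin_max by (simp add: unit_vec_def)
qed

lemma min_resolution_length_le:
  fixes Q :: "nat \<Rightarrow> ('a, 'q) module"
  assumes Q: "projective_resolution R M Q d' e'" and n: "\<And>i. i > n \<Longrightarrow> carrier (Q i) = {\<zero>\<^bsub>Q i\<^esub>}"
    and j: "j > n"
  shows "S j = {}"
proof (rule ccontr)
  assume "S j \<noteq> {}"
  then obtain s where s: "s \<in> S j" by blast
  let ?F = "\<lambda>i. fmod R (S i)"
  interpret F: projective_complex R ?F d by (rule min_resolution_complex)
  interpret Q: projective_complex R Q d' by (rule projective_complexI[OF is_cring Q])
  note QD = projective_resolutionD[OF Q]
  note FD = min_resolutionD
  interpret M: module R M by (rule M)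
  have "\<exists>\<alpha>. (\<forall>i. linmap R (?F i) (Q i) (\<alpha> i)) \<and> (\<forall>x\<in>carrier (?F 0). e' (\<alpha> 0 x) = e x) \<and>
    (\<forall>i. \<forall>x\<in>carrier (?F (Suc i)). d' i (\<alpha> (Suc i) x) = \<alpha> i (d i x))"
  proof (rule F.chain_map_lift[OF M FD(2) _ Q.module_P Q.linmap_d QD(1,2)])
    fix x assume "x \<in> carrier (?F 1)"
    then have "d 0 x \<in> d 0 ` carrier (?F (Suc 0))" by simp
    then show "e (d 0 x) = \<zero>\<^bsub>M\<^esub>" by (simp add: FD(5))
  qed (simp_all add: QD(3,4)[simplified])
  then obtain \<alpha> where \<alpha>: "\<And>i. linmap R (?F i) (Q i) (\<alpha> i)"
      "\<And>x. x \<in> carrier (?F 0) \<Longrightarrow> e' (\<alpha> 0 x) = e x"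
      "\<And>i x. x \<in> carrier (?F (Suc i)) \<Longrightarrow> d' i (\<alpha> (Suc i) x) = \<alpha> i (d i x)" by blast
  have "\<exists>\<beta>. (\<forall>i. linmap R (Q i) (?F i) (\<beta> i)) \<and> (\<forall>x\<in>carrier (Q 0). e (\<beta> 0 x) = e' x) \<and>
    (\<forall>i. \<forall>x\<in>carrier (Q (Suc i)). d i (\<beta> (Suc i) x) = \<beta> i (d' i x))"
  proof (rule Q.chain_map_lift[OF M QD(1) _ F.module_P F.linmap_d FD(2,3)])
    fix x assume "x \<in> carrier (Q 1)"
    then have "d' 0 x \<in> d' 0 ` carrier (Q 1)" by simp
    then show "e' (d' 0 x) = \<zero>\<^bsub>M\<^esub>" by (simp only: QD(3)) simp
  qed (simp_all add: FD(5,6))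
  then obtain \<beta> where \<beta>: "\<And>i. linmap R (Q i) (?F i) (\<beta> i)"
      "\<And>x. x \<in> carrier (Q 0) \<Longrightarrow> e (\<beta> 0 x) = e' x"
      "\<And>i x. x \<in> carrier (Q (Suc i)) \<Longrightarrow> d i (\<beta> (Suc i) x) = \<beta> i (d' i x)" by blast
  \<comment> \<open>Both comparison maps lie over the identity of \<open>M\<close>, so \<phi> covers
    the zero map of \<open>M\<close> and is null-homotopic.\<close>
  define \<phi> where "\<phi> i x = \<beta> i (\<alpha> i x) \<ominus>\<^bsub>?F i\<^esub> x" for i x
  have \<beta>\<alpha>: "linmap R (?F i) (?F i) (\<lambda>x. \<beta> i (\<alpha> i x))" for i
    by (rule linmap_comp[OF \<alpha>(1) \<beta>(1)])
  have \<phi>: "linmap R (?F i) (?F i) (\<phi> i)" for i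
    unfolding \<phi>_def by (intro linmap_diff module_fmod \<beta>\<alpha> linmap_id)
  have "\<exists>h. (\<forall>i. linmap R (?F i) (?F (Suc i)) (h i)) \<and>
    (\<forall>x\<in>carrier (?F 0). d 0 (h 0 x) = \<phi> 0 x) \<and>
    (\<forall>i. \<forall>x\<in>carrier (?F (Suc i)). d (Suc i) (h (Suc i) x) = \<phi> (Suc i) x \<ominus>\<^bsub>?F (Suc i)\<^esub> h i (d i x))"
  proof (rule F.null_homotopy[OF F.module_P F.linmap_d _ \<phi>])
    fix i x assume x: "x \<in> carrier (?F (Suc i))"
    have "d i (\<phi> (Suc i) x) = d i (\<beta> (Suc i) (\<alpha> (Suc i) x)) \<ominus>\<^bsub>?F i\<^esub> d i x"
      unfolding \<phi>_def
      by (rule linmap_minus[OF module_fmod module_fmod FD(4) linmap_closed[OF \<beta>\<alpha> x] x])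
    also have "d i (\<beta> (Suc i) (\<alpha> (Suc i) x)) = \<beta> i (\<alpha> i (d i x))"
      using \<beta>(3)[OF linmap_closed[OF \<alpha>(1) x]] \<alpha>(3)[OF x] by simp
    finally show "d i (\<phi> (Suc i) x) = \<phi> i (d i x)" by (simp add: \<phi>_def)
  next
    show "\<phi> 0 ` carrier (?F 0) \<subseteq> d 0 ` carrier (?F 1)"
    proof
      fix y assume "y \<in> \<phi> 0 ` carrier (?F 0)"
      then obtain x where x: "x \<in> carrier (?F 0)" "y = \<phi> 0 x" by blast
      have "e (\<phi> 0 x) = e (\<beta> 0 (\<alpha> 0 x)) \<ominus>\<^bsub>M\<^esub> e x"
        unfolding \<phi>_def by (rule linmap_minus[OF module_fmod M FD(2) linmap_closed[OF \<beta>\<alpha> x(1)] x(1)])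
      also have "e (\<beta> 0 (\<alpha> 0 x)) = e x"
        using \<beta>(2)[OF linmap_closed[OF \<alpha>(1) x(1)]] \<alpha>(2)[OF x(1)] by simp
      finally have "e (\<phi> 0 x) = \<zero>\<^bsub>M\<^esub>" using linmap_closed[OF FD(2) x(1)] by simp
      then show "y \<in> d 0 ` carrier (?F 1)"
        using linmap_closed[OF \<phi> x(1)] x(2) by (simp add: FD(5))
    qed
  qed (simp add: FD(6))
  then obtain h where h: "\<And>i. linmap R (?F i) (?F (Suc i)) (h i)"
    "\<And>i x. x \<in> carrier (?F (Suc i)) \<Longrightarrow>
      d (Suc i) (h (Suc i) x) = \<phi> (Suc i) x \<ominus>\<^bsub>?F (Suc i)\<^esub> h i (d i x)" by blast
  obtain i where i: "j = Suc i" using j by (cases j) auto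
  let ?u = "unit_vec R s"
  have u: "?u \<in> carrier (?F (Suc i))" using unit_vec_closed[OF s] i by simp
  have "\<alpha> (Suc i) ?u = \<zero>\<^bsub>Q (Suc i)\<^esub>" using linmap_closed[OF \<alpha>(1) u] n[of "Suc i"] j i by simp
  then have "\<beta> (Suc i) (\<alpha> (Suc i) ?u) = \<zero>\<^bsub>?F (Suc i)\<^esub>"
    by (simp add: linmap_zero[OF Q.module_P module_fmod \<beta>(1)])
  moreover have du: "h i (d i ?u) \<in> carrier (?F (Suc i))"
    by (rule linmap_closed[OF h(1) linmap_closed[OF FD(4) u]])
  moreover have "\<phi> (Suc i) ?u \<in> carrier (?F (Suc i))" by (rule linmap_closed[OF \<phi> u])
  moreover have "\<zero>\<^bsub>?F (Suc i)\<^esub> \<in> carrier (?F (Suc i))"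
    by (rule linmap_closed[OF linmap_const_zero[OF module_fmod] u])
  \<comment> \<open>In degree j the map \<alpha> lands in a zero module, so \<phi> sends the basis
    vector to its negative. At coordinate \<open>s\<close> the homotopy equation reads: an element
    of \<mm> equals - \<one> minus an element of \<mm>.\<close>
  ultimately have "d (Suc i) (h (Suc i) ?u) s = (\<zero> \<ominus> \<one>) \<ominus> h i (d i ?u) s"
    using h(2)[OF u] u by (simp add: \<phi>_def fmod_minus) (simp add: fmod_simps unit_vec_def)
  moreover have "d (Suc i) (h (Suc i) ?u) s \<in> \<mm>"
    by (rule FD(7)[OF linmap_closed[OF h(1) u]])
  moreover have hm: "h i (d i ?u) s \<in> \<mm>"
    by (rule linmap_fmod_max[OF h(1) linmap_closed[OF FD(4) u] FD(7)[OF u]])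
  ultimately have "((\<zero> \<ominus> \<one>) \<ominus> h i (d i ?u) s) \<oplus> h i (d i ?u) s \<in> \<mm>"
    by simp
  also have "((\<zero> \<ominus> \<one>) \<ominus> h i (d i ?u) s) \<oplus> h i (d i ?u) s = \<ominus> \<one>"
    using fmodD(1)[OF du] by (simp add: minus_eq a_assoc l_neg)
  finally have "\<ominus> (\<ominus> \<one>) \<in> \<mm>" by (rule \<mm>.a_inv_closed)
  then show False using one_notin_max by simp
qed

lemma min_resolution_projective_resolution:
  "projective_resolution R M (\<lambda>i. fmod R (S i)) (\<lambda>i. restrict (d i) (carrier (fmod R (S (Suc i)))))
    (restrict e (carrier (fmod R (S 0))))"
  unfolding projective_resolution_def
  using min_resolutionD
  by (auto simp: a_kernel_def' projective_fmod intro!: restrict_mod_hom module_fmod)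

end

text \<open>\<open>S\<close> is indexed by the very list type that \<open>proj_dim\<close>
  prescribes, so a minimal resolution competes in its infimum; conversely
  \<open>min_resolution_length_le\<close> bounds its length by that of an optimal
  resolution.\<close>

lemma proj_dim_min_resolution:
  fixes M :: "('a, 'm, 'c) module_scheme"
  assumes fg: "fin_gen_module R M" and nz: "carrier M \<noteq> {\<zero>\<^bsub>M\<^esub>}" and fin: "proj_dim R M \<noteq> \<infinity>"
  shows "\<exists>n (S :: nat \<Rightarrow> ('a + 'm) list set) d e. min_resolution M S d e \<and>
    proj_dim R M = enat n \<and> S n \<noteq> {} \<and> (\<forall>j>n. S j = {})"
proof -
  have M: "module R M" using fg by (simp add: fin_gen_module_def)
  have inf: "infinite (UNIV :: ('a + 'm) list set)" by (rule infinite_UNIV_listI)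
  obtain S :: "nat \<Rightarrow> ('a + 'm) list set" and d e where res: "min_resolution M S d e"
    using min_resolution_exists[OF inf fg] by blast
  let ?A = "{enat n | n. \<exists>(P :: nat \<Rightarrow> ('a, ('a, 'm) res) module) d \<epsilon>.
      projective_resolution R M P d \<epsilon> \<and> (\<forall>i>n. carrier (P i) = {\<zero>\<^bsub>P i\<^esub>})}"
  have pd: "proj_dim R M = Inf ?A" by (simp only: proj_dim_def)
  have "?A \<noteq> {}"
  proof
    assume "?A = {}"
    with fin pd show False by (simp only: Inf_empty) (simp add: top_enat_def)
  qed
  then obtain k where "k \<in> ?A" by blast
  \<comment> \<open>The infimum of a nonempty set of extended naturals is attained, here by an
    actual resolution.\<close>
  then have "Inf ?A \<in> ?A" by (rule wellorder_InfI)
  then obtain n and Q :: "nat \<Rightarrow> ('a, ('a, 'm) res) module" and d' e' where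
    n: "Inf ?A = enat n" "projective_resolution R M Q d' e'" "\<forall>i>n. carrier (Q i) = {\<zero>\<^bsub>Q i\<^esub>}"
    by blast
  have empty: "S j = {}" if "j > n" for j
    by (rule min_resolution_length_le[OF M res n(2) _ that]) (use n(3) in blast)
  have le: "n \<le> k" if "\<And>j. j > k \<Longrightarrow> S j = {}" for k
  proof -
    have "enat k \<in> ?A"
      using min_resolution_projective_resolution[OF M res] that
      by (force simp: carrier_fmod_empty)
    then have "Inf ?A \<le> enat k" by (rule Inf_lower)
    then show ?thesis using n(1) by simp
  qed
  \<comment> \<open>Otherwise the minimal resolution would be shorter than the infimum, or, for n =
    0, \<open>M\<close> would be zero.\<close>
  have "S n \<noteq> {}"
  proof
    assume Sn: "S n = {}"
    show False
    proof (cases n)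
      case 0
      then have "carrier M = e ` {\<zero>\<^bsub>fmod R {}\<^esub>}"
        using Sn min_resolutionD(3)[OF M res] by (simp add: carrier_fmod_empty)
      moreover have "e \<zero>\<^bsub>fmod R {}\<^esub> = \<zero>\<^bsub>M\<^esub>"
        using Sn 0 linmap_zero[OF module_fmod M min_resolutionD(2)[OF M res]] by simp
      ultimately show False using nz by simp
    next
      case (Suc k)
      have "S j = {}" if "j > k" for j
        using that Sn empty[of j] Suc by (cases "j = n") auto
      then show False using le[of k] Suc by simp
    qed
  qed
  then show ?thesis using res pd n(1) empty by (intro exI[of _ n] exI[of _ S] exI[of _ d] exI[of _ e]) simp
qed

end

section \<open>Depth along a minimal resolution\<close>

context projective_complex
begin

text \<open>Attached to the complex P; for the chosen resolution of the residue field it is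
  \<open>depth\<close>, by \<open>depth_eq_dep\<close>.\<close>

definition dep :: "('a, 'm, 'c) module_scheme \<Rightarrow> enat"
  where "dep A = Inf {enat i | i. \<not> vanishes A i}"

lemma vanishes_below_dep:
  assumes "enat i < dep A"
  shows "vanishes A i"
proof (rule ccontr)
  assume "\<not> vanishes A i"
  then have "dep A \<le> enat i" unfolding dep_def by (intro Inf_lower) blast
  with assms show False by simp
qed

lemma dep_witness:
  assumes "dep A = enat i"
  shows "\<not> vanishes A i"
proof -
  have "{enat i | i. \<not> vanishes A i} \<noteq> {}"
  proof
    assume "{enat i | i. \<not> vanishes A i} = {}"
    then have "dep A = \<infinity>" by (simp only: dep_def Inf_empty) (simp add: top_enat_def)
    with assms show False by simp
  qed
  then obtain k where "k \<in> {enat i | i. \<not> vanishes A i}" by blast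
  then have "dep A \<in> {enat i | i. \<not> vanishes A i}" unfolding dep_def by (rule wellorder_InfI)
  with assms show ?thesis by auto
qed

lemma dep_le: "\<not> vanishes A i \<Longrightarrow> dep A \<le> enat i"
  using vanishes_below_dep[of i A] by (cases "enat i < dep A") auto

lemma dep_eq_infinity: "(\<And>i. vanishes A i) \<Longrightarrow> dep A = \<infinity>"
  using dep_witness[of A] by (cases "dep A") auto

lemma dep_eqI: "(\<And>i. vanishes A i \<longleftrightarrow> vanishes B i) \<Longrightarrow> dep A = dep B"
  by (simp add: dep_def)

lemma dep_iso:
  assumes "module R A" "module R B" "linmap R A B f" "inj_on f (carrier A)" "f ` carrier A = carrier B"
  shows "dep A = dep B"
proof -
  have "\<exists>g. linmap R B A g \<and> (\<forall>y\<in>carrier B. f (g y) = y)"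
    using linmap_factor[OF assms(2,1,3,4) linmap_id] assms(5) by simp
  then obtain g where g: "linmap R B A g" "\<And>y. y \<in> carrier B \<Longrightarrow> f (g y) = y" by blast
  have "g (f x) = x" if x: "x \<in> carrier A" for x
  proof (rule inj_onD[OF assms(4)])
    show "f (g (f x)) = f x" using g(2)[OF linmap_closed[OF assms(3) x]] .
    show "g (f x) \<in> carrier A" by (rule linmap_closed[OF g(1) linmap_closed[OF assms(3) x]])
  qed (rule x)
  with g show ?thesis
    using vanishes_retract[OF assms(1-3) g] vanishes_retract[OF assms(2,1) g(1) assms(3)]
    by (intro dep_eqI) blast
qed

text \<open>For i + 1 < \<open>dep K\<close> both Ext^i(F) and Ext^(i+1)(K) vanish, which forces
  Ext^i(M) = 0. In degree n = \<open>dep K\<close> the zero map makes Ext^(n-1)(M) surject onto the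
  nonzero Ext^n(K).\<close>

lemma dep_short_exact:
  assumes ses: "short_exact R K F M \<phi> \<psi>" and le: "dep K \<le> dep F"
    and zero: "\<And>i z. enat i \<le> dep K \<Longrightarrow> cocycle K i z \<Longrightarrow> coboundary F i (\<lambda>x. \<phi> (z x))"
  shows "1 + dep M = dep K"
proof -
  have van: "vanishes M i" if "enat (Suc i) < dep K" for i
  proof (rule vanishes_quotient[OF ses])
    have "enat i < enat (Suc i)" by simp
    also note that
    also note le
    finally show "vanishes F i" by (rule vanishes_below_dep)
    show "vanishes K (Suc i)" by (rule vanishes_below_dep[OF that])
  qed
  show ?thesis
  proof (cases "dep K")
    case infinity
    then have "dep M = \<infinity>" by (intro dep_eq_infinity van) simp
    with infinity show ?thesis by simp
  next
    case (enat n)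
    have n: "\<not> vanishes K n" by (rule dep_witness[OF enat])
    \<comment> \<open>Excludes \<open>dep K\<close> = 0, where there would be no degree n -
      1.\<close>
    have "vanishes K 0" if "n = 0"
      by (rule vanishes_kernel_0[OF ses]) (use zero[of 0] enat that in simp)
    with n obtain j where j: "n = Suc j" by (cases n) auto
    have "\<not> vanishes M j"
    proof
      assume "vanishes M j"
      then have "vanishes K (Suc j)"
        by (rule vanishes_kernel[OF ses]) (use zero[of "Suc j"] enat j in simp)
      with n j show False by simp
    qed
    then have "dep M \<le> enat j" by (rule dep_le)
    moreover have "\<not> dep M < enat j"
    proof
      assume less: "dep M < enat j"
      then obtain i where i: "dep M = enat i" by (cases "dep M") auto
      then have "vanishes M i" using less enat j by (intro van) simp
      with dep_witness[OF i] show False by simp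
    qed
    ultimately have "dep M = enat j" by simp
    then show ?thesis using enat j by (simp add: one_enat_def)
  qed
qed

text \<open>Bounding maps are found coordinatewise; since \<open>T\<close> is finite, the assembled
  map has finite support.\<close>

lemma coboundary_fmod:
  assumes T: "finite T" and z: "linmap R (P i) (fmod R T) z"
    and cob: "\<And>t. t \<in> T \<Longrightarrow> coboundary (self_module R) i (\<lambda>x. z x t)"
  shows "coboundary (fmod R T) i z"
proof -
  have z0: "z x t = \<zero>" if "x \<in> carrier (P i)" "t \<notin> T" for x t
    by (rule fmodD(2)[OF linmap_closed[OF z that(1)] that(2)])
  show ?thesis
  proof (cases i)
    case 0
    have "z x t = \<zero>" if "x \<in> carrier (P 0)" for x t
      using cob[of t] z0[of x t] that by (cases "t \<in> T") (auto simp: 0 coboundary_0 self_simps)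
    then show ?thesis by (simp add: 0 coboundary_0 fmod_simps fun_eq_iff)
  next
    case (Suc j)
    have "\<forall>t\<in>T. \<exists>w. linmap R (P j) (self_module R) w \<and> (\<forall>x\<in>carrier (P i). z x t = w (d j x))"
      using cob by (simp add: Suc coboundary_Suc)
    then obtain w where w: "\<And>t. t \<in> T \<Longrightarrow> linmap R (P j) (self_module R) (w t)"
      "\<And>t x. t \<in> T \<Longrightarrow> x \<in> carrier (P i) \<Longrightarrow> z x t = w t (d j x)" by metis
    let ?w = "\<lambda>x t. if t \<in> T then w t x else \<zero>"
    have "linmap R (P j) (fmod R T) ?w"
      unfolding linmap_def
    proof (intro conjI ballI)
      fix x y a assume x: "x \<in> carrier (P j)"
      show "?w x \<in> carrier (fmod R T)"
        using linmap_closed[OF w(1) x] by (simp add: fmod_carrier_finite[OF T] self_simps)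
      show "?w (x \<oplus>\<^bsub>P j\<^esub> y) = ?w x \<oplus>\<^bsub>fmod R T\<^esub> ?w y" if "y \<in> carrier (P j)"
        using linmap_add[OF w(1) x that] by (simp add: fmod_simps self_simps fun_eq_iff)
      show "?w (a \<odot>\<^bsub>P j\<^esub> x) = a \<odot>\<^bsub>fmod R T\<^esub> ?w x" if "a \<in> carrier R"
        using linmap_smult[OF w(1) that x] that by (simp add: fmod_simps self_simps fun_eq_iff)
    qed
    moreover have "z x = ?w (d j x)" if "x \<in> carrier (P i)" for x
      using w(2) z0 that by (simp add: fun_eq_iff)
    ultimately show ?thesis unfolding Suc coboundary_Suc by (intro exI[of _ ?w]) (simp add: Suc)
  qed
qed

text \<open>R is a retract of the free module through one coordinate, which exists as
  \<open>T\<close> is nonempty; the converse is coordinatewise.\<close>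

lemma dep_fmod:
  assumes T: "finite T" "T \<noteq> {}"
  shows "dep (fmod R T) = dep (self_module R)"
proof (rule dep_eqI)
  fix i
  obtain t where t: "t \<in> T" using T(2) by blast
  let ?g = "\<lambda>a x. if x = t then a else \<zero>"
  have g: "linmap R (self_module R) (fmod R T) ?g"
    using t by (auto simp: linmap_def self_simps fmod_simps fmod_carrier_finite[OF T(1)])
  have "vanishes (self_module R) i" if "vanishes (fmod R T) i"
    by (rule vanishes_retract[OF module_fmod module_self linmap_coordinate[of T t] g _ that]) simp
  moreover have "vanishes (fmod R T) i" if v: "vanishes (self_module R) i"
    unfolding vanishes_def
  proof (intro allI impI)
    fix z assume z: "cocycle (fmod R T) i z"
    show "coboundary (fmod R T) i z"
    proof (rule coboundary_fmod[OF T(1)])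
      show "linmap R (P i) (fmod R T) z" using z by (simp add: cocycle_def)
      fix s
      have "cocycle (self_module R) i (\<lambda>x. z x s)"
        by (rule cocycle_comp[OF module_fmod module_self linmap_coordinate z])
      then show "coboundary (self_module R) i (\<lambda>x. z x s)" using v by (simp add: vanishes_def)
    qed
  qed
  ultimately show "vanishes (fmod R T) i \<longleftrightarrow> vanishes (self_module R) i" by blast
qed

end

text \<open>
  The complexes to which this applies are projective resolutions of the residue field; all that is
  used of them is that multiplication by an element of the maximal ideal is null-homotopic.
\<close>

locale residue_complex = noetherian_local_ring R \<mm> + projective_complex R P d
  for R :: "('a, 'b) ring_scheme" (structure) and \<mm> and P :: "nat \<Rightarrow> ('a, 'p) module" and d +
  assumes homotopy: "a \<in> \<mm> \<Longrightarrow> \<exists>h. (\<forall>i. linmap R (P i) (P (Suc i)) (h i)) \<and>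
    (\<forall>x\<in>carrier (P 0). d 0 (h 0 x) = a \<odot>\<^bsub>P 0\<^esub> x) \<and>
    (\<forall>i. \<forall>x\<in>carrier (P (Suc i)).
      d (Suc i) (h (Suc i) x) = a \<odot>\<^bsub>P (Suc i)\<^esub> x \<ominus>\<^bsub>P (Suc i)\<^esub> h i (d i x))"
begin

text \<open>With a = d h + h d and z d = 0 one gets a z = (z h) d, a coboundary. In degree 0 the
  term h d is absent and a z = 0. Hence \<mm> annihilates the cohomology.\<close>

lemma coboundary_scale_max:
  assumes A: "module R A" and z: "cocycle A i z" and a: "a \<in> \<mm>"
  shows "coboundary A i (\<lambda>x. a \<odot>\<^bsub>A\<^esub> z x)"
proof -
  interpret A: module R A by fact
  have aR: "a \<in> carrier R" by (rule \<mm>.Icarr[OF a])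
  obtain h where h: "\<And>i. linmap R (P i) (P (Suc i)) (h i)"
    "\<And>x. x \<in> carrier (P 0) \<Longrightarrow> d 0 (h 0 x) = a \<odot>\<^bsub>P 0\<^esub> x"
    "\<And>i x. x \<in> carrier (P (Suc i)) \<Longrightarrow>
      d (Suc i) (h (Suc i) x) = a \<odot>\<^bsub>P (Suc i)\<^esub> x \<ominus>\<^bsub>P (Suc i)\<^esub> h i (d i x)"
    using homotopy[OF a] by blast
  have zl: "linmap R (P i) A z" and z0: "\<And>x. x \<in> carrier (P (Suc i)) \<Longrightarrow> z (d i x) = \<zero>\<^bsub>A\<^esub>"
    using z by (auto simp: cocycle_def)
  show ?thesis
  proof (cases i)
    case 0
    have "a \<odot>\<^bsub>A\<^esub> z x = \<zero>\<^bsub>A\<^esub>" if x: "x \<in> carrier (P 0)" for x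
    proof -
      have "z (d 0 (h 0 x)) = \<zero>\<^bsub>A\<^esub>" using z0[unfolded 0] linmap_closed[OF h(1) x] by blast
      moreover have "z (a \<odot>\<^bsub>P 0\<^esub> x) = a \<odot>\<^bsub>A\<^esub> z x"
        using linmap_smult[OF zl[unfolded 0] aR x] .
      ultimately show ?thesis using h(2)[OF x] by simp
    qed
    then show ?thesis by (simp add: 0 coboundary_0)
  next
    case (Suc j)
    have "a \<odot>\<^bsub>A\<^esub> z x = z (h j (d j x))" if x: "x \<in> carrier (P (Suc j))" for x
    proof -
      interpret Pj: module R "P (Suc j)" by (rule module_P)
      have zl': "linmap R (P (Suc j)) A z" using zl Suc by simp
      have hd: "h j (d j x) \<in> carrier (P (Suc j))" by (rule linmap_closed[OF h(1) d_closed[OF x]])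
      have zx: "z x \<in> carrier A" "z (h j (d j x)) \<in> carrier A"
        by (rule linmap_closed[OF zl' x], rule linmap_closed[OF zl' hd])
      have ax: "a \<odot>\<^bsub>P (Suc j)\<^esub> x \<in> carrier (P (Suc j))" using aR x by simp
      have "\<zero>\<^bsub>A\<^esub> = z (d (Suc j) (h (Suc j) x))"
        using z0[unfolded Suc, OF linmap_closed[OF h(1) x]] by simp
      also have "\<dots> = z (a \<odot>\<^bsub>P (Suc j)\<^esub> x) \<ominus>\<^bsub>A\<^esub> z (h j (d j x))"
        by (simp only: h(3)[OF x] linmap_minus[OF module_P A zl' ax hd])
      also have "z (a \<odot>\<^bsub>P (Suc j)\<^esub> x) = a \<odot>\<^bsub>A\<^esub> z x" by (rule linmap_smult[OF zl' aR x])
      finally have "a \<odot>\<^bsub>A\<^esub> z x \<ominus>\<^bsub>A\<^esub> z (h j (d j x)) = \<zero>\<^bsub>A\<^esub>" by simp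
      then have "(a \<odot>\<^bsub>A\<^esub> z x \<ominus>\<^bsub>A\<^esub> z (h j (d j x))) \<oplus>\<^bsub>A\<^esub> z (h j (d j x)) = z (h j (d j x))"
        using zx by simp
      then show ?thesis using zx aR by (simp add: A.M.minus_eq A.M.a_assoc A.M.l_neg)
    qed
    then show ?thesis using linmap_comp[OF h(1)[of j]] zl Suc
      unfolding Suc coboundary_Suc by (intro exI[of _ "\<lambda>x. z (h j x)"]) auto
  qed
qed

text \<open>l z is the sum over s of l(e_s) z_s, where e_s is the basis vector at s. Each z_s is a
  cocycle and each l(e_s) lies in \<mm>, so \<open>coboundary_scale_max\<close> applies to every
  summand.\<close>

lemma coboundary_functional_max:
  assumes S: "finite S" and l: "linmap R (fmod R S) (self_module R) l"
    and lm: "\<And>f. f \<in> carrier (fmod R S) \<Longrightarrow> l f \<in> \<mm>" and z: "cocycle (fmod R S) i z"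
  shows "coboundary (self_module R) i (\<lambda>x. l (z x))"
proof -
  interpret F: module R "fmod R S" by (rule module_fmod)
  interpret A: module R "self_module R" by (rule module_self)
  have zl: "linmap R (P i) (fmod R S) z" using z by (simp add: cocycle_def)
  have zF: "z x \<in> carrier (fmod R S)" if "x \<in> carrier (P i)" for x by (rule linmap_closed[OF zl that])
  \<comment> \<open>Truncating \<open>z\<close> to the coordinates in \<open>U\<close> gives the
    partial sums.\<close>
  have "coboundary (self_module R) i (\<lambda>x. l (\<lambda>s. if s \<in> U then z x s else \<zero>))"
    if "finite U" "U \<subseteq> S" for U
    using that
  proof (induction U rule: finite_induct)
    case empty
    have "l \<zero>\<^bsub>fmod R S\<^esub> = \<zero>\<^bsub>self_module R\<^esub>" by (rule linmap_zero[OF module_fmod module_self l])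
    then have "l (\<lambda>s. \<zero>) = \<zero>\<^bsub>self_module R\<^esub>" by (simp add: fmod_simps)
    then show ?case using coboundary_zero[OF module_self] by simp
  next
    case (insert u U)
    have u: "unit_vec R u \<in> carrier (fmod R S)" using insert.prems by (intro unit_vec_closed) simp
    let ?a = "l (unit_vec R u)" and ?r = "\<lambda>x s. if s \<in> U then z x s else \<zero>"
    have "coboundary (self_module R) i (\<lambda>x. ?a \<odot>\<^bsub>self_module R\<^esub> z x u \<oplus>\<^bsub>self_module R\<^esub> l (?r x))"
      by (intro coboundary_plus module_self coboundary_scale_max lm u
        cocycle_comp[OF module_fmod module_self linmap_coordinate z] insert.IH)
        (use insert.prems in simp)
    then show ?case
    proof (rule coboundary_cong)
      fix x assume x: "x \<in> carrier (P i)"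
      have r: "?r x \<in> carrier (fmod R S)"
        using fmodD[OF zF[OF x]] insert.prems by (auto simp: fmod_carrier_finite[OF S])
      have zu: "z x u \<in> carrier R" by (rule fmodD(1)[OF zF[OF x]])
      have "(\<lambda>s. if s \<in> insert u U then z x s else \<zero>)
          = z x u \<odot>\<^bsub>fmod R S\<^esub> unit_vec R u \<oplus>\<^bsub>fmod R S\<^esub> ?r x"
        using insert.hyps(2) fmodD(1)[OF zF[OF x]] by (auto simp: fmod_simps unit_vec_def fun_eq_iff)
      then have "l (\<lambda>s. if s \<in> insert u U then z x s else \<zero>)
          = z x u \<odot>\<^bsub>self_module R\<^esub> ?a \<oplus>\<^bsub>self_module R\<^esub> l (?r x)"
        using u r zu by (simp add: linmap_add[OF l] linmap_smult[OF l])
      then show "?a \<odot>\<^bsub>self_module R\<^esub> z x u \<oplus>\<^bsub>self_module R\<^esub> l (?r x)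
          = l (\<lambda>s. if s \<in> insert u U then z x s else \<zero>)"
        using zu \<mm>.Icarr[OF lm[OF u]] by (simp add: self_simps m_comm)
    qed
  qed
  from this[OF S subset_refl] show ?thesis
  proof (rule coboundary_cong)
    fix x assume x: "x \<in> carrier (P i)"
    have "(\<lambda>s. if s \<in> S then z x s else \<zero>) = z x" using fmodD(2)[OF zF[OF x]] by auto
    then show "l (\<lambda>s. if s \<in> S then z x s else \<zero>) = l (z x)" by simp
  qed
qed

lemma coboundary_comp_max:
  assumes S: "finite S" and T: "finite T" and f: "linmap R (fmod R S) (fmod R T) f"
    and fm: "\<And>y t. y \<in> carrier (fmod R S) \<Longrightarrow> f y t \<in> \<mm>" and z: "cocycle (fmod R S) i z"
  shows "coboundary (fmod R T) i (\<lambda>x. f (z x))"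
proof (rule coboundary_fmod[OF T])
  show "linmap R (P i) (fmod R T) (\<lambda>x. f (z x))"
    using z by (intro linmap_comp[OF _ f]) (simp add: cocycle_def)
  fix t
  show "coboundary (self_module R) i (\<lambda>x. f (z x) t)"
    by (rule coboundary_functional_max[OF S linmap_comp[OF f linmap_coordinate] fm z])
qed

text \<open>An empty \<open>S (Suc 0)\<close> makes \<open>e\<close> injective, so \<open>M\<close>
  is isomorphic to the free module on the nonempty set \<open>S 0\<close>.\<close>

lemma dep_min_resolution_0:
  assumes M: "module R M" and res: "min_resolution M S d' e" and S: "S 0 \<noteq> {}" "S (Suc 0) = {}"
  shows "dep M = dep (self_module R)"
proof -
  note D = min_resolutionD[OF M res]
  have "inj_on e (carrier (fmod R (S 0)))"
  proof (rule inj_onI)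
    interpret F: module R "fmod R (S 0)" by (rule module_fmod)
    interpret M: module R M by fact
    fix x y assume xy: "x \<in> carrier (fmod R (S 0))" "y \<in> carrier (fmod R (S 0))" "e x = e y"
    have "e (x \<ominus>\<^bsub>fmod R (S 0)\<^esub> y) = \<zero>\<^bsub>M\<^esub>"
      using xy linmap_closed[OF D(2)] by (simp add: linmap_minus[OF module_fmod M D(2)])
    then have "x \<ominus>\<^bsub>fmod R (S 0)\<^esub> y \<in> d' 0 ` carrier (fmod R (S (Suc 0)))" using xy by (simp add: D(5))
    also have "\<dots> = {\<zero>\<^bsub>fmod R (S 0)\<^esub>}"
      using linmap_zero[OF module_fmod module_fmod D(4)[of 0]] S(2) by (simp add: carrier_fmod_empty)
    finally have "(x \<ominus>\<^bsub>fmod R (S 0)\<^esub> y) \<oplus>\<^bsub>fmod R (S 0)\<^esub> y = y" using xy by simp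
    then show "x = y" using xy by (simp add: F.M.minus_eq F.M.a_assoc F.M.l_neg)
  qed
  then have "dep (fmod R (S 0)) = dep M" by (rule dep_iso[OF module_fmod M D(2) _ D(3)])
  then show ?thesis using dep_fmod[OF D(1) S(1)] by simp
qed

text \<open>\<open>K\<close> is the first syzygy. It keeps the operations of
  \<open>fmod R (S 0)\<close>, so the inclusion is the identity function and the shifted resolution
  can be reused as it is.\<close>

lemma min_resolution_kernel:
  assumes M: "module R M" and res: "min_resolution M S d' e"
  defines "K \<equiv> (fmod R (S 0))\<lparr>carrier := {f \<in> carrier (fmod R (S 0)). e f = \<zero>\<^bsub>M\<^esub>}\<rparr>"
  shows "module R K" "min_resolution K (\<lambda>i. S (Suc i)) (\<lambda>i. d' (Suc i)) (d' 0)"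
    "short_exact R K (fmod R (S 0)) M (\<lambda>x. x) e"
proof -
  note D = min_resolutionD[OF M res]
  interpret F: module R "fmod R (S 0)" by (rule module_fmod)
  interpret M: module R M by fact
  have e0: "e \<zero>\<^bsub>fmod R (S 0)\<^esub> = \<zero>\<^bsub>M\<^esub>" by (rule linmap_zero[OF module_fmod M D(2)])
  have sub: "submodule {f \<in> carrier (fmod R (S 0)). e f = \<zero>\<^bsub>M\<^esub>} R (fmod R (S 0))"
  proof (rule F.submoduleI)
    fix f assume f: "f \<in> {f \<in> carrier (fmod R (S 0)). e f = \<zero>\<^bsub>M\<^esub>}"
    have "\<ominus>\<^bsub>fmod R (S 0)\<^esub> f = (\<ominus> \<one>) \<odot>\<^bsub>fmod R (S 0)\<^esub> f" using f by (simp add: F.smult_l_minus)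
    then show "\<ominus>\<^bsub>fmod R (S 0)\<^esub> f \<in> {f \<in> carrier (fmod R (S 0)). e f = \<zero>\<^bsub>M\<^esub>}"
      using f by (simp add: linmap_smult[OF D(2)])
  qed (auto simp: e0 linmap_add[OF D(2)] linmap_smult[OF D(2)])
  show K: "module R K" unfolding K_def by (rule submodule.submodule_is_module[OF sub module_fmod])
  have d0: "linmap R (fmod R (S (Suc 0))) K (d' 0)"
    using D(4)[of 0] D(5) unfolding K_def linmap_submodule_iff by (auto simp: linmap_def)
  show "min_resolution K (\<lambda>i. S (Suc i)) (\<lambda>i. d' (Suc i)) (d' 0)"
    using res d0 D(5) unfolding min_resolution_def K_def by (simp add: fmod_simps)
  show "short_exact R K (fmod R (S 0)) M (\<lambda>x. x) e"
    unfolding short_exact_def using K M D(2,3) module_fmod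
    by (auto simp: K_def linmap_def)
qed

text \<open>The inductive step for one syzygy. The equation for \<open>?K\<close> yields
  \<open>dep ?K\<close> \<le> \<open>dep (self_module R)\<close>, and its summand \<open>n\<close>
  decides why the map from Ext of \<open>?K\<close> to Ext of \<open>fmod R (S 0)\<close> is
  zero.\<close>

lemma dep_min_resolution_Suc:
  assumes M: "module R M" and res: "min_resolution M S d' e"
    and n: "S (Suc n) \<noteq> {}" "S (Suc (Suc n)) = {}"
    and K: "enat n + dep ((fmod R (S 0))\<lparr>carrier := {f \<in> carrier (fmod R (S 0)). e f = \<zero>\<^bsub>M\<^esub>}\<rparr>)
      = dep (self_module R)" (is "_ + dep ?K = _")
  shows "enat (Suc n) + dep M = dep (self_module R)"
proof -
  note D = min_resolutionD[OF M res]
  note KD = min_resolution_kernel[OF M res]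
  have "S 0 \<noteq> {}"
  proof
    assume S0: "S 0 = {}"
    have "S j = {}" for j
      by (induction j) (use S0 min_resolution_empty_Suc[OF M res] in auto)
    with n(1) show False by simp
  qed
  then have F: "dep (fmod R (S 0)) = dep (self_module R)" by (rule dep_fmod[OF D(1)])
  have "1 + dep M = dep ?K"
  proof (rule dep_short_exact[OF KD(3)])
    show "dep ?K \<le> dep (fmod R (S 0))" unfolding F K[symmetric] by simp
    fix i z assume i: "enat i \<le> dep ?K" and z: "cocycle ?K i z"
    show "coboundary (fmod R (S 0)) i z"
    proof (cases n)
      \<comment> \<open>\<open>?K\<close> is free here: \<open>d' 0\<close> is injective, so z is
        \<open>d' 0\<close> after a cocycle u of a free module, and the entries of
        \<open>d' 0\<close> lie in \<mm>.\<close>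
      case 0
      interpret F1: module R "fmod R (S (Suc 0))" by (rule module_fmod)
      interpret F0: module R "fmod R (S 0)" by (rule module_fmod)
      have zl: "linmap R (P i) ?K z" and z0: "\<And>x. x \<in> carrier (P (Suc i)) \<Longrightarrow> z (d i x) = \<zero>\<^bsub>fmod R (S 0)\<^esub>"
        using z by (auto simp: cocycle_def)
      have zl': "linmap R (P i) (fmod R (S 0)) z" using zl by (auto simp: linmap_def)
      have inj: "inj_on (d' 0) (carrier (fmod R (S (Suc 0))))"
      proof (rule inj_onI)
        fix x y assume xy: "x \<in> carrier (fmod R (S (Suc 0)))" "y \<in> carrier (fmod R (S (Suc 0)))"
          "d' 0 x = d' 0 y"
        have "d' 0 (x \<ominus>\<^bsub>fmod R (S (Suc 0))\<^esub> y) = \<zero>\<^bsub>fmod R (S 0)\<^esub>"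
          using xy linmap_closed[OF D(4)[of 0]] by (simp add: linmap_minus[OF module_fmod module_fmod D(4)])
        then have "x \<ominus>\<^bsub>fmod R (S (Suc 0))\<^esub> y \<in> d' (Suc 0) ` carrier (fmod R (S (Suc (Suc 0))))"
          using xy by (simp add: D(6))
        also have "\<dots> = {\<zero>\<^bsub>fmod R (S (Suc 0))\<^esub>}"
          using linmap_zero[OF module_fmod module_fmod D(4)[of "Suc 0"]] n(2) 0
          by (simp add: carrier_fmod_empty)
        finally have "(x \<ominus>\<^bsub>fmod R (S (Suc 0))\<^esub> y) \<oplus>\<^bsub>fmod R (S (Suc 0))\<^esub> y = y" using xy by simp
        then show "x = y" using xy by (simp add: F1.M.minus_eq F1.M.a_assoc F1.M.l_neg)
      qed
      have "\<exists>u. linmap R (P i) (fmod R (S (Suc 0))) u \<and> (\<forall>x\<in>carrier (P i). d' 0 (u x) = z x)"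
        by (rule linmap_factor[OF module_P module_fmod D(4) inj zl'])
          (use linmap_closed[OF zl] in \<open>simp add: D(5)\<close>)
      then obtain u where u: "linmap R (P i) (fmod R (S (Suc 0))) u"
        "\<And>x. x \<in> carrier (P i) \<Longrightarrow> d' 0 (u x) = z x" by blast
      have "cocycle (fmod R (S (Suc 0))) i u"
        unfolding cocycle_def
      proof (intro conjI ballI u(1))
        fix x assume x: "x \<in> carrier (P (Suc i))"
        show "u (d i x) = \<zero>\<^bsub>fmod R (S (Suc 0))\<^esub>"
        proof (rule inj_onD[OF inj])
          show "d' 0 (u (d i x)) = d' 0 \<zero>\<^bsub>fmod R (S (Suc 0))\<^esub>"
            using x by (simp add: u(2) d_closed z0 linmap_zero[OF module_fmod module_fmod D(4)])
          show "u (d i x) \<in> carrier (fmod R (S (Suc 0)))"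
            by (rule linmap_closed[OF u(1) d_closed[OF x]])
        qed simp
      qed
      then have "coboundary (fmod R (S 0)) i (\<lambda>x. d' 0 (u x))"
        by (intro coboundary_comp_max[OF D(1) D(1) D(4)]) (rule D(7))
      then show ?thesis by (rule coboundary_cong) (simp add: u(2))
    next
      case (Suc m)
      \<comment> \<open>If \<open>dep ?K\<close> is finite, adding \<open>n\<close> > 0 makes the
        depth of R strictly larger; if it is infinite, so is the depth of R, and i is
        finite.\<close>
      have "enat i < dep (self_module R)"
        using i K[symmetric] Suc by (cases "dep ?K") auto
      then have "vanishes (fmod R (S 0)) i" using F by (intro vanishes_below_dep) simp
      moreover have "cocycle (fmod R (S 0)) i z" using z by (auto simp: cocycle_def linmap_def)
      ultimately show ?thesis by (simp add: vanishes_def)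
    qed
  qed
  moreover have "enat (Suc n) = enat n + 1" by (simp add: one_enat_def)
  ultimately show ?thesis using K by (simp add: add.assoc)
qed

text \<open>The induction replaces \<open>M\<close> by its syzygy, whose elements have type
  \<open>'x \<Rightarrow> 'a\<close>. An induction cannot change the type of \<open>M\<close>, so it
  runs inside that type, and \<open>dep_min_resolution\<close> makes the first step for other
  types.\<close>

lemma dep_min_resolution_fun:
  fixes M :: "('a, 'x \<Rightarrow> 'a) module" and S :: "nat \<Rightarrow> 'x set"
  assumes "module R M" "min_resolution M S d' e" "S n \<noteq> {}" "S (Suc n) = {}"
  shows "enat n + dep M = dep (self_module R)"
  using assms
proof (induction n arbitrary: M S d' e)
  case 0
  then show ?case using dep_min_resolution_0 by (simp add: zero_enat_def[symmetric])
next
  case (Suc n)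
  note K = min_resolution_kernel[OF Suc.prems(1,2)]
  show ?case
    by (rule dep_min_resolution_Suc[OF Suc.prems Suc.IH[OF K(1,2) Suc.prems(3,4)]])
qed

lemma dep_min_resolution:
  assumes M: "module R M" and res: "min_resolution M S d' e" and n: "S n \<noteq> {}" "S (Suc n) = {}"
  shows "enat n + dep M = dep (self_module R)"
proof (cases n)
  case 0
  then show ?thesis using dep_min_resolution_0[OF M res] n by (simp add: zero_enat_def[symmetric])
next
  case (Suc k)
  note K = min_resolution_kernel[OF M res]
  have "enat k + dep ((fmod R (S 0))\<lparr>carrier := {f \<in> carrier (fmod R (S 0)). e f = \<zero>\<^bsub>M\<^esub>}\<rparr>)
      = dep (self_module R)"
    using n Suc by (intro dep_min_resolution_fun[OF K(1,2)]) simp_all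
  then show ?thesis unfolding Suc using n Suc by (intro dep_min_resolution_Suc[OF M res]) simp_all
qed

end

section \<open>The residue field and Ext\<close>

context noetherian_local_ring
begin

abbreviation residue_field :: "('a, 'a set) module"
  where "residue_field \<equiv> quot_module (self_module R) \<mm>"

lemma residue_field_simps:
  "carrier residue_field = (\<lambda>x. \<mm> +> x) ` carrier R" "\<zero>\<^bsub>residue_field\<^esub> = \<mm> +> \<zero>"
  "x \<in> carrier R \<Longrightarrow> y \<in> carrier R \<Longrightarrow>
    (\<mm> +> x) \<oplus>\<^bsub>residue_field\<^esub> (\<mm> +> y) = \<mm> +> (x \<oplus> y)"
  "a \<in> carrier R \<Longrightarrow> x \<in> carrier R \<Longrightarrow> a \<odot>\<^bsub>residue_field\<^esub> (\<mm> +> x) = \<mm> +> (a \<otimes> x)"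
proof -
  have cos: "\<mm> +>\<^bsub>self_module R\<^esub> x = \<mm> +> x" for x
    by (simp add: a_r_coset_def' self_simps)
  show "carrier residue_field = (\<lambda>x. \<mm> +> x) ` carrier R"
    by (auto simp: quot_module_def A_RCOSETS_def' cos self_simps)
  have "\<mm> +> \<zero> = \<mm>" using \<mm>.a_subset by (auto simp: a_r_coset_def')
  then show "\<zero>\<^bsub>residue_field\<^esub> = \<mm> +> \<zero>" by (simp add: quot_module_def)
  show "(\<mm> +> x) \<oplus>\<^bsub>residue_field\<^esub> (\<mm> +> y) = \<mm> +> (x \<oplus> y)" if "x \<in> carrier R" "y \<in> carrier R"
    using \<mm>.a_rcos_sum[OF that] by (simp add: quot_module_def set_add_def' self_simps)
  assume a: "a \<in> carrier R" and x: "x \<in> carrier R"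
  \<comment> \<open>Scaling in \<open>quot_module\<close> is the union of the cosets of all scaled
    representatives; they coincide, which collapses the union to one coset.\<close>
  have eq: "\<mm> +> (a \<otimes> y) = \<mm> +> (a \<otimes> x)" if y: "y \<in> \<mm> +> x" for y
  proof -
    obtain h where h: "h \<in> \<mm>" "y = h \<oplus> x" using y by (auto simp: a_r_coset_def')
    have hR: "h \<in> carrier R" by (rule \<mm>.Icarr[OF h(1)])
    have "a \<otimes> y \<ominus> a \<otimes> x = a \<otimes> h"
      using a x hR by (simp add: h(2) r_distr minus_eq a_assoc r_neg)
    then have "a \<otimes> y \<ominus> a \<otimes> x \<in> \<mm>" using \<mm>.I_l_closed[OF h(1) a] by simp
    then show ?thesis using a x hR h(2) quotient_eq_iff_same_a_r_cos[OF \<mm>.is_ideal] by simp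
  qed
  have "\<zero> \<oplus> x \<in> \<mm> +> x" unfolding a_r_coset_def' using \<mm>.zero_closed by blast
  then have ne: "\<mm> +> x \<noteq> {}" by blast
  have "a \<odot>\<^bsub>residue_field\<^esub> (\<mm> +> x) = (\<Union>y\<in>\<mm> +> x. \<mm> +> (a \<otimes> y))"
    by (simp only: quot_module_def module.simps cos self_simps)
  also have "\<dots> = (\<Union>y\<in>\<mm> +> x. \<mm> +> (a \<otimes> x))" by (rule SUP_cong[OF refl eq])
  also have "\<dots> = \<mm> +> (a \<otimes> x)" using ne by simp
  finally show "a \<odot>\<^bsub>residue_field\<^esub> (\<mm> +> x) = \<mm> +> (a \<otimes> x)" .
qed

lemma module_residue_field: "module R residue_field"
proof (rule moduleI[OF is_cring], rule abelian_groupI, goal_cases)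
  case (6 X)
  then obtain x where x: "x \<in> carrier R" "X = \<mm> +> x" by (auto simp: residue_field_simps)
  then have "(\<mm> +> (\<ominus> x)) \<oplus>\<^bsub>residue_field\<^esub> X = \<zero>\<^bsub>residue_field\<^esub>"
    by (simp add: residue_field_simps(2,3) l_neg)
  then show ?case using x by (auto simp: residue_field_simps(1))
qed (auto simp: residue_field_simps a_ac l_distr r_distr m_assoc)

lemma residue_field_annihilated:
  assumes "a \<in> \<mm>" "X \<in> carrier residue_field"
  shows "a \<odot>\<^bsub>residue_field\<^esub> X = \<zero>\<^bsub>residue_field\<^esub>"
proof -
  obtain x where x: "x \<in> carrier R" "X = \<mm> +> x" using assms(2) by (auto simp: residue_field_simps)
  have a: "a \<in> carrier R" by (rule \<mm>.Icarr[OF assms(1)])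
  have "a \<otimes> x \<ominus> \<zero> \<in> \<mm>" using \<mm>.I_r_closed[OF assms(1) x(1)] a x by simp
  then have "\<mm> +> (a \<otimes> x) = \<mm> +> \<zero>"
    using a x quotient_eq_iff_same_a_r_cos[OF \<mm>.is_ideal, of "a \<otimes> x" \<zero>] by simp
  then show ?thesis using a x by (simp add: residue_field_simps)
qed

lemma fin_gen_residue_field: "fin_gen_module R residue_field"
  unfolding fin_gen_module_def
proof (intro conjI exI[of _ "{\<mm> +> \<one>}"] ballI module_residue_field)
  interpret k: module R residue_field by (rule module_residue_field)
  show one: "{\<mm> +> \<one>} \<subseteq> carrier residue_field" by (auto simp: residue_field_simps)
  fix X assume "X \<in> carrier residue_field"
  then obtain x where x: "x \<in> carrier R" "X = \<mm> +> x" by (auto simp: residue_field_simps)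
  have "(\<Oplus>\<^bsub>residue_field\<^esub>s\<in>{\<mm> +> \<one>}. x \<odot>\<^bsub>residue_field\<^esub> s) = x \<odot>\<^bsub>residue_field\<^esub> (\<mm> +> \<one>)"
    using one x by (subst k.M.finsum_insert) auto
  also have "\<dots> = X" using x by (simp add: residue_field_simps)
  finally show "\<exists>c\<in>{\<mm> +> \<one>} \<rightarrow> carrier R. X = (\<Oplus>\<^bsub>residue_field\<^esub>s\<in>{\<mm> +> \<one>}. c s \<odot>\<^bsub>residue_field\<^esub> s)"
    using x by (intro bexI[of _ "\<lambda>_. x"]) auto
qed simp

text \<open>Multiplication by an element of \<mm> is zero on the residue field, so it takes
  \<open>P 0\<close> into the kernel of \<epsilon>, the image of \<open>d 0\<close>, and
  \<open>null_homotopy\<close> applies.\<close>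

lemma residue_complexI:
  assumes "projective_resolution R residue_field P d \<epsilon>"
  shows "residue_complex R \<mm> P d"
proof -
  interpret C: projective_complex R P d by (rule projective_complexI[OF is_cring assms])
  note D = projective_resolutionD[OF assms]
  show ?thesis
  proof
    fix a assume a: "a \<in> \<mm>"
    have aR: "a \<in> carrier R" by (rule \<mm>.Icarr[OF a])
    show "\<exists>h. (\<forall>i. linmap R (P i) (P (Suc i)) (h i)) \<and>
      (\<forall>x\<in>carrier (P 0). d 0 (h 0 x) = a \<odot>\<^bsub>P 0\<^esub> x) \<and>
      (\<forall>i. \<forall>x\<in>carrier (P (Suc i)).
        d (Suc i) (h (Suc i) x) = a \<odot>\<^bsub>P (Suc i)\<^esub> x \<ominus>\<^bsub>P (Suc i)\<^esub> h i (d i x))"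
    proof (rule C.null_homotopy[where Q = P and d' = d and \<phi> = "\<lambda>i x. a \<odot>\<^bsub>P i\<^esub> x", OF C.module_P C.linmap_d])
      show "linmap R (P i) (P i) (\<lambda>x. a \<odot>\<^bsub>P i\<^esub> x)" for i
        by (intro linmap_scale C.module_P linmap_id aR)
      show "d i (a \<odot>\<^bsub>P (Suc i)\<^esub> x) = a \<odot>\<^bsub>P i\<^esub> d i x" if "x \<in> carrier (P (Suc i))" for i x
        by (rule linmap_smult[OF C.linmap_d aR that])
      show "(\<lambda>x. a \<odot>\<^bsub>P 0\<^esub> x) ` carrier (P 0) \<subseteq> d 0 ` carrier (P 1)"
      proof safe
        fix x assume x: "x \<in> carrier (P 0)"
        have "\<epsilon> (a \<odot>\<^bsub>P 0\<^esub> x) = \<zero>\<^bsub>residue_field\<^esub>"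
          using residue_field_annihilated[OF a linmap_closed[OF D(1) x]]
          by (simp add: linmap_smult[OF D(1) aR x])
        moreover have "a \<odot>\<^bsub>P 0\<^esub> x \<in> carrier (P 0)" by (rule module.smult_closed[OF C.module_P aR x])
        ultimately show "a \<odot>\<^bsub>P 0\<^esub> x \<in> d 0 ` carrier (P 1)" unfolding D(3) by simp
      qed
    qed (simp add: D(4))
  qed
qed

text \<open>\<open>SOME\<close> yields a resolution provided that one exists in the prescribed
  element type; a minimal resolution indexed by lists is one.\<close>

lemma chosen_resolution_residue_field:
  assumes "chosen_resolution R residue_field = (P, d)"
  shows "residue_complex R \<mm> P d"
proof -
  have inf: "infinite (UNIV :: ('a + 'a set) list set)" by (rule infinite_UNIV_listI)
  obtain S :: "nat \<Rightarrow> ('a + 'a set) list set" and d' e where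
    res: "min_resolution residue_field S d' e"
    using min_resolution_exists[OF inf fin_gen_residue_field] by blast
  let ?Q = "\<lambda>(P :: nat \<Rightarrow> ('a, ('a, 'a set) res) module, d). \<exists>\<epsilon>. projective_resolution R residue_field P d \<epsilon>"
  have "\<exists>p. ?Q p"
    using min_resolution_projective_resolution[OF module_residue_field res] by auto
  then have "?Q (SOME p. ?Q p)" by (rule someI_ex)
  then have "?Q (P, d)" using assms by (simp only: chosen_resolution_def)
  then show ?thesis using residue_complexI by auto
qed

end

section \<open>From the cocycle predicates back to the Ext modules\<close>

context projective_complex
begin

lemma coboundary_closed:
  assumes "module R A" "coboundary A i z" "x \<in> carrier (P i)"
  shows "z x \<in> carrier A"
proof -
  interpret A: module R A by fact
  show ?thesis
    using assms(2,3) by (cases i) (auto simp: coboundary_0 coboundary_Suc linmap_closed d_closed)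
qed

lemma cocycles_iff:
  "f \<in> cocycles R P d A i \<longleftrightarrow> f \<in> extensional (carrier (P i)) \<and> cocycle A i f"
proof -
  have "codiff P d i f = \<zero>\<^bsub>hom_module R (P (Suc i)) A\<^esub> \<longleftrightarrow>
      (\<forall>x\<in>carrier (P (Suc i)). f (d i x) = \<zero>\<^bsub>A\<^esub>)"
    by (auto simp: codiff_def hom_module_def compose_def fun_eq_iff restrict_def)
  then show ?thesis
    by (auto simp: cocycles_def a_kernel_def' mod_hom_iff cocycle_def)
qed

lemma coboundaries_iff:
  "f \<in> coboundaries R P d A i \<longleftrightarrow> f \<in> extensional (carrier (P i)) \<and> coboundary A i f"
proof (cases i)
  case 0
  show ?thesis
    by (auto simp: 0 coboundary_0 hom_module_def extensional_def fun_eq_iff restrict_def)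
next
  case (Suc j)
  have "f \<in> coboundaries R P d A i" if f: "f \<in> extensional (carrier (P i))" "coboundary A i f"
  proof -
    obtain w where w: "linmap R (P j) A w" "\<And>x. x \<in> carrier (P i) \<Longrightarrow> f x = w (d j x)"
      using f(2) by (auto simp: Suc coboundary_Suc)
    have "f = codiff P d j (restrict w (carrier (P j)))"
      using f(1) w(2) d_closed[of _ j]
      by (auto simp: codiff_def compose_def Suc extensional_def fun_eq_iff)
    then show ?thesis using restrict_mod_hom[OF module_P w(1)] by (simp add: Suc)
  qed
  moreover have "f \<in> extensional (carrier (P i)) \<and> coboundary A i f"
    if f: "f \<in> coboundaries R P d A i"
  proof -
    obtain w where "w \<in> mod_hom R (P j) A" "f = codiff P d j w" using f unfolding Suc coboundaries.simps by blast
    then show ?thesis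
      by (auto simp: Suc coboundary_Suc codiff_def compose_def mod_hom_iff)
  qed
  ultimately show ?thesis by blast
qed

lemma vanishes_iff:
  assumes A: "module R A"
  shows "vanishes A i \<longleftrightarrow> cocycles R P d A i \<subseteq> coboundaries R P d A i"
proof
  assume "vanishes A i"
  then show "cocycles R P d A i \<subseteq> coboundaries R P d A i"
    by (auto simp: vanishes_def cocycles_iff coboundaries_iff)
next
  assume sub: "cocycles R P d A i \<subseteq> coboundaries R P d A i"
  show "vanishes A i"
    unfolding vanishes_def
  proof (intro allI impI)
    fix z assume z: "cocycle A i z"
    \<comment> \<open>The elements of \<open>cocycles\<close> are extensional, so \<open>z\<close>
      is cut down to the carrier, which neither predicate can see.\<close>
    let ?z = "restrict z (carrier (P i))"
    have "cocycle A i ?z"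
      using z linmap_cong[OF module_P, of i z ?z A] by (auto simp: cocycle_def d_closed)
    then have "?z \<in> cocycles R P d A i" by (simp add: cocycles_iff)
    with sub have "coboundary A i ?z" by (auto simp: coboundaries_iff)
    then show "coboundary A i z" by (rule coboundary_cong) simp
  qed
qed

lemma ext_quotient_trivial_iff:
  fixes i :: nat
  assumes A: "module R A"
  defines "E \<equiv> quot_module ((hom_module R (P i) A)\<lparr>carrier := cocycles R P d A i\<rparr>)
    (coboundaries R P d A i)"
  shows "carrier E = {\<zero>\<^bsub>E\<^esub>} \<longleftrightarrow> vanishes A i"
proof -
  interpret A: module R A by fact
  let ?Z = "cocycles R P d A i" and ?B = "coboundaries R P d A i"
  let ?add = "\<lambda>f g. \<lambda>x\<in>carrier (P i). f x \<oplus>\<^bsub>A\<^esub> g x"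
  have E: "carrier E = (\<lambda>z. (\<lambda>b. ?add b z) ` ?B) ` ?Z" "\<zero>\<^bsub>E\<^esub> = ?B"
    by (auto simp: E_def quot_module_def A_RCOSETS_def' a_r_coset_def' hom_module_def)
  let ?o = "\<lambda>x\<in>carrier (P i). \<zero>\<^bsub>A\<^esub>"
  have cob0: "coboundary A i ?o" by (rule coboundary_cong[OF coboundary_zero[OF A]]) simp
  have B0: "?o \<in> ?B" using cob0 by (simp add: coboundaries_iff)
  have "cocycle A i (\<lambda>x. \<zero>\<^bsub>A\<^esub>)" by (simp add: cocycle_def linmap_const_zero[OF A])
  then have "cocycle A i ?o"
    using linmap_cong[OF module_P, of i "\<lambda>x. \<zero>\<^bsub>A\<^esub>" ?o A] by (auto simp: cocycle_def d_closed)
  \<comment> \<open>Some cocycle exists, so when all cosets equal \<open>?B\<close> the carrier is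
    the singleton of \<open>?B\<close> and not empty.\<close>
  then have Z0: "?o \<in> ?Z" by (simp add: cocycles_iff)
  have ZA: "z x \<in> carrier A" if "z \<in> ?Z" "x \<in> carrier (P i)" for z x
    using that linmap_closed[of R "P i" A z x] by (simp add: cocycles_iff cocycle_def)
  show ?thesis
  proof
    assume triv: "carrier E = {\<zero>\<^bsub>E\<^esub>}"
    have "?Z \<subseteq> ?B"
    proof
      fix z assume z: "z \<in> ?Z"
      have "(\<lambda>b. ?add b z) ` ?B \<in> carrier E" unfolding E by (rule imageI[OF z])
      then have "(\<lambda>b. ?add b z) ` ?B = ?B" by (simp only: triv E(2) singleton_iff)
      moreover have "?add ?o z = z"
        using z ZA[OF z] by (auto simp: cocycles_iff extensional_def fun_eq_iff)
      ultimately show "z \<in> ?B" using imageI[OF B0, of "\<lambda>b. ?add b z"] by simp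
    qed
    then show "vanishes A i" using vanishes_iff[OF A] by blast
  next
    assume "vanishes A i"
    then have ZB: "?Z \<subseteq> ?B" using vanishes_iff[OF A] by blast
    have add: "?add b c \<in> ?B" if "b \<in> ?B" "c \<in> ?B" for b c
      using coboundary_plus[OF A, of i b c] that
      by (auto simp: coboundaries_iff intro: coboundary_cong)
    have "(\<lambda>b. ?add b z) ` ?B = ?B" if z: "z \<in> ?Z" for z
    proof
      show "(\<lambda>b. ?add b z) ` ?B \<subseteq> ?B" using add z ZB by blast
      show "?B \<subseteq> (\<lambda>b. ?add b z) ` ?B"
      proof
        fix b assume b: "b \<in> ?B"
        \<comment> \<open>The negative of \<open>z\<close>, written as a multiple so that
          \<open>coboundary_comp\<close> shows it to be a coboundary.\<close>
        let ?n = "\<lambda>x\<in>carrier (P i). (\<ominus> \<one>) \<odot>\<^bsub>A\<^esub> z x"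
        have "coboundary A i z" using z ZB by (auto simp: coboundaries_iff)
        then have "coboundary A i (\<lambda>x. (\<ominus> \<one>) \<odot>\<^bsub>A\<^esub> z x)"
          by (intro coboundary_comp[OF A A linmap_scale[OF A linmap_id]]) simp_all
        then have "coboundary A i ?n" by (rule coboundary_cong) simp
        then have n: "?n \<in> ?B" by (simp add: coboundaries_iff)
        have "b x \<in> carrier A" if "x \<in> carrier (P i)" for x
          using b that by (intro coboundary_closed[OF A]) (auto simp: coboundaries_iff)
        then have "?add (?add b ?n) z = b"
          using b ZA[OF z]
          by (auto simp: coboundaries_iff extensional_def fun_eq_iff A.smult_l_minus A.M.a_assoc A.M.l_neg)
        then show "b \<in> (\<lambda>b. ?add b z) ` ?B" using add[OF b n] by (intro image_eqI[of _ _ "?add b ?n"]) simp_all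
      qed
    qed
    then have "carrier E = (\<lambda>z. ?B) ` ?Z" unfolding E by (rule image_cong[OF refl])
    then show "carrier E = {\<zero>\<^bsub>E\<^esub>}" using Z0 E(2) by auto
  qed
qed

end

lemma (in noetherian_local_ring) depth_eq_dep:
  assumes "chosen_resolution R residue_field = (P, d)" and A: "module R A"
  shows "depth R \<mm> A = projective_complex.dep R P d A"
proof -
  interpret residue_complex R \<mm> P d by (rule chosen_resolution_residue_field[OF assms(1)])
  have "carrier (Ext R i residue_field A) = {\<zero>\<^bsub>Ext R i residue_field A\<^esub>} \<longleftrightarrow> vanishes A i" for i
    using ext_quotient_trivial_iff[OF A] by (simp add: Ext_def assms(1))
  then show ?thesis by (simp add: depth_def depth_pair_def dep_def)
qed

theorem theorem1p1:
  fixes R :: "('r, 'a) ring_scheme" and \<mm> :: "'r set" and M :: "('r, 'm, 'b) module_scheme"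
  assumes "noetherian_ring R" and "local_ring R \<mm>"
    and "fin_gen_module R M" and "carrier M \<noteq> {\<zero>\<^bsub>M\<^esub>}"
    and "proj_dim R M \<noteq> \<infinity>"
  shows "proj_dim R M + depth R \<mm> M = depth R \<mm> (self_module R)"
proof -
  interpret noetherian_local_ring R \<mm>
    using assms(1,2)
    by (intro noetherian_local_ring.intro noetherian_local_ring_axioms.intro)
      (simp_all add: local_ring_def)
  have M: "module R M" using assms(3) by (simp add: fin_gen_module_def)
  \<comment> \<open>Both depths in the formula are computed with this one resolution, so both sides
    speak about the same \<open>dep\<close>.\<close>
  obtain P d where Pd: "chosen_resolution R residue_field = (P, d)" by (cases "chosen_resolution R residue_field")
  interpret residue_complex R \<mm> P d by (rule chosen_resolution_residue_field[OF Pd])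
  obtain n and S :: "nat \<Rightarrow> ('r + 'm) list set" and d' e where
    res: "min_resolution M S d' e" and pd: "proj_dim R M = enat n"
    and S: "S n \<noteq> {}" "\<forall>j>n. S j = {}"
    using proj_dim_min_resolution[OF assms(3-5)] by blast
  have "enat n + dep M = dep (self_module R)"
    using S by (intro dep_min_resolution[OF M res]) simp_all
  then show ?thesis by (simp add: pd depth_eq_dep[OF Pd] M module_self)
qed

end
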